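(* Let $\mathbb{D}^2\subset\mathbb{C}^2$ be the unit polydisc and let $f:\mathbb{D}^2\to\mathbb{C}^2$ be defined by $f(z_1,z_2)=\left(\frac{1}{3-z_1-z_2},\,z_1\right)$. Then $f$ is a Bergman coordinate on $\mathbb{D}^2$, yet $f(\mathbb{D}^2)$ fails to be a quadrature domain.
   Context: $\mathbb{D}^2=\{(z_1,z_2)\in\mathbb{C}^2:|z_1|<1,|z_2|<1\}$. For a domain $\Omega\subset\mathbb{C}^n$, $H^2(\Omega)$ is the Bergman space of holomorphic functions on $\Omega$ square-integrable with respect to Lebesgue measure, and $K(z,w)$ is its Bergman kernel: holomorphic in $z$, antiholomorphic in $w$, with $\int_\Omega f(w)K(z,w)\,dV(w)=f(z)$ for all $f\in H^2(\Omega)$. The Bergman span of $\Omega$ is the complex linear span of the functions $z\mapsto\frac{\partial^\alpha}{\partial\bar w^\alpha}K(z,w)|_{w=w_0}$, where $\alpha$ ranges over multi-indices and $w_0$ ranges over $\Omega$. A domain $\Omega$ is a quadrature domain (for $H^2$ functions) if there exist finitely many points $z_i\in\Omega$ and constants $c_{i\alpha}$ with $\int_\Omega f\,dV=\sum_{i,\alpha}c_{i\alpha}\frac{\partial^\alpha f}{\partial z^\alpha}(z_i)$ for all $f\in H^2(\Omega)$ (for finite-volume domains, equivalently: the constant function $1$ is in the Bergman span). A (global) Bergman coordinate of $\Omega$ is a biholomorphic mapping defined on $\Omega$ (onto its image in $\mathbb{C}^n$), each of whose component functions is a quotient of elements of the Bergman span of $\Omega$ (with denominator not identically zero). *)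

theory Defs
  imports "HOL-Analysis.Analysis"
begin

definition is_domain :: "(complex ^ 'n::finite) set \<Rightarrow> bool" where
  "is_domain \<Omega> \<longleftrightarrow> open \<Omega> \<and> connected \<Omega> \<and> \<Omega> \<noteq> {}"

definition unit_polydisc :: "(complex ^ 2) set" where
  "unit_polydisc = {z. norm (z $ 1) < 1 \<and> norm (z $ 2) < 1}"

(* The library's holomorphic_on covers functions of one variable only.  For functions of
   several variables we ask for a Frechet derivative that is complex linear. *)
definition mv_holomorphic_on ::
    "(complex ^ 'n::finite \<Rightarrow> complex) \<Rightarrow> (complex ^ 'n) set \<Rightarrow> bool" where
  "mv_holomorphic_on f \<Omega> \<longleftrightarrow>
     (\<forall>z\<in>\<Omega>. \<exists>D. (f has_derivative D) (at z) \<and> (\<forall>c v. D (c *s v) = c * D v))"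

definition holomorphic_map_on ::
    "(complex ^ 'n::finite \<Rightarrow> complex ^ 'm::finite) \<Rightarrow> (complex ^ 'n) set \<Rightarrow> bool" where
  "holomorphic_map_on f \<Omega> \<longleftrightarrow> (\<forall>j. mv_holomorphic_on (\<lambda>z. f z $ j) \<Omega>)"

definition biholomorphic_on ::
    "(complex ^ 'n::finite \<Rightarrow> complex ^ 'n) \<Rightarrow> (complex ^ 'n) set \<Rightarrow> bool" where
  "biholomorphic_on f \<Omega> \<longleftrightarrow>
     holomorphic_map_on f \<Omega> \<and> inj_on f \<Omega> \<and> open (f ` \<Omega>) \<and>
     holomorphic_map_on (the_inv_into \<Omega> f) (f ` \<Omega>)"

(* Elements of the Bergman space are total functions; only their values on \<Omega> matter. *)
definition bergman_space :: "(complex ^ 'n::finite) set \<Rightarrow> (complex ^ 'n \<Rightarrow> complex) set" where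
  "bergman_space \<Omega> =
     {f. mv_holomorphic_on f \<Omega> \<and> set_integrable lborel \<Omega> (\<lambda>z. (norm (f z))\<^sup>2)}"

(* Square integrability of w \<mapsto> K z w makes the integral meaningful and determines K
   uniquely on \<Omega> \<times> \<Omega>. *)
definition is_bergman_kernel ::
    "(complex ^ 'n::finite) set \<Rightarrow> (complex ^ 'n \<Rightarrow> complex ^ 'n \<Rightarrow> complex) \<Rightarrow> bool" where
  "is_bergman_kernel \<Omega> K \<longleftrightarrow>
     (\<forall>w\<in>\<Omega>. mv_holomorphic_on (\<lambda>z. K z w) \<Omega>) \<and>
     (\<forall>z\<in>\<Omega>. (\<lambda>w. cnj (K z w)) \<in> bergman_space \<Omega>) \<and>
     (\<forall>f\<in>bergman_space \<Omega>. \<forall>z\<in>\<Omega>. (LINT w:\<Omega>|lborel. f w * K z w) = f z)"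

(* The values outside \<Omega> \<times> \<Omega> are arbitrary and never used below. *)
definition bergman_kernel ::
    "(complex ^ 'n::finite) set \<Rightarrow> complex ^ 'n \<Rightarrow> complex ^ 'n \<Rightarrow> complex" where
  "bergman_kernel \<Omega> = (SOME K. is_bergman_kernel \<Omega> K)"

definition partial_z ::
    "'n::finite \<Rightarrow> (complex ^ 'n \<Rightarrow> complex) \<Rightarrow> complex ^ 'n \<Rightarrow> complex" where
  "partial_z j g z = deriv (\<lambda>t. g (z + axis j t)) 0"

(* The Wirtinger derivative (d/dx_j + i d/dy_j) / 2, where z_j = x_j + i y_j. *)
definition partial_zbar ::
    "'n::finite \<Rightarrow> (complex ^ 'n \<Rightarrow> complex) \<Rightarrow> complex ^ 'n \<Rightarrow> complex" where
  "partial_zbar j g z =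
     (vector_derivative (\<lambda>t::real. g (z + axis j (of_real t))) (at 0) +
      \<i> * vector_derivative (\<lambda>t::real. g (z + axis j (\<i> * of_real t))) (at 0)) / 2"

(* Applies d j exactly \<alpha> j times for every coordinate j.  The order of the coordinates is
   fixed by the linear order on the index type; it is immaterial for the (anti)holomorphic
   functions to which this is applied, as their partial derivatives commute. *)
definition multi_partial ::
    "('n \<Rightarrow> (complex ^ 'n::{finite,linorder} \<Rightarrow> complex) \<Rightarrow>
        complex ^ 'n::{finite,linorder} \<Rightarrow> complex) \<Rightarrow>
     ('n \<Rightarrow> nat) \<Rightarrow> (complex ^ 'n::{finite,linorder} \<Rightarrow> complex) \<Rightarrow>
     complex ^ 'n::{finite,linorder} \<Rightarrow> complex" where
  "multi_partial d \<alpha> g = fold (\<lambda>j. d j ^^ \<alpha> j) (sorted_list_of_set UNIV) g"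

(* As for the Bergman space, a function belongs to the span according to its values on \<Omega>. *)
definition bergman_span ::
    "(complex ^ 'n::{finite,linorder}) set \<Rightarrow>
     (complex ^ 'n::{finite,linorder} \<Rightarrow> complex) set" where
  "bergman_span \<Omega> =
     {g. \<exists>S c. finite S \<and> S \<subseteq> \<Omega> \<times> UNIV \<and>
           (\<forall>z\<in>\<Omega>. g z =
              (\<Sum>(w, \<alpha>)\<in>S. c w \<alpha> * multi_partial partial_zbar \<alpha> (bergman_kernel \<Omega> z) w))}"

(* Integrability of f is demanded because a divergent Bochner integral is 0 by convention; it
   is automatic when \<Omega> has finite volume. *)
definition quadrature_domain :: "(complex ^ 'n::{finite,linorder}) set \<Rightarrow> bool" where
  "quadrature_domain \<Omega> \<longleftrightarrow> is_domain \<Omega> \<and>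
     (\<exists>S c. finite S \<and> S \<subseteq> \<Omega> \<times> UNIV \<and>
        (\<forall>f\<in>bergman_space \<Omega>. set_integrable lborel \<Omega> f \<and>
           (LINT z:\<Omega>|lborel. f z) = (\<Sum>(z, \<alpha>)\<in>S. c z \<alpha> * multi_partial partial_z \<alpha> f z)))"

(* The denominator q may vanish somewhere in \<Omega>, but not identically. *)
definition bergman_coordinate ::
    "(complex ^ 'n::{finite,linorder}) set \<Rightarrow>
     (complex ^ 'n::{finite,linorder} \<Rightarrow> complex ^ 'n::{finite,linorder}) \<Rightarrow> bool" where
  "bergman_coordinate \<Omega> f \<longleftrightarrow> is_domain \<Omega> \<and> biholomorphic_on f \<Omega> \<and>
     (\<forall>j. \<exists>p\<in>bergman_span \<Omega>. \<exists>q\<in>bergman_span \<Omega>.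
        (\<exists>z\<in>\<Omega>. q z \<noteq> 0) \<and> (\<forall>z\<in>\<Omega>. q z \<noteq> 0 \<longrightarrow> f z $ j = p z / q z))"

end

(*
  The Bergman kernel of the bidisc is the product of the kernels of the discs; its values and first
  derivatives at w = 0 show that all affine functions lie in the Bergman span, so both components
  of f are quotients of elements of the span.

  For the negative part, the slice of f(D^2) at height b in the second variable is the image of a
  disc under inversion, hence again a disc, and the mean value property integrates it. With
  A = 3 - b, its centre is cnj A / (|A|^2 - 1). For a holomorphic P and a real x in (1/4, 1/2) let
    h (w1, w2) = P w2 / (w1 * (x + (1 - 3 x) (3 - w2)) - (1 - 3 x))^2.
  Then h is bounded on f(D^2), and the slice integral of h over b is pi * P b / (1 - x * cnj b)^2, so
  the integral of h is pi^2 * P x by the reproducing property in the disc. Choosing for P a polynomial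
  that vanishes to high order at the second coordinates of the nodes of a putative quadrature formula,
  but not at x, makes the quadrature sum 0 and the integral nonzero.
*)
theory Submission
  imports Defs "HOL-Complex_Analysis.Cauchy_Integral_Formula"
begin

section \<open>Lebesgue measure under isometries\<close>

text \<open>By change of variables, a quadrature identity on the image would place the Jacobian
  determinant -1/(3 - z1 - z2)^2 of f in the Bergman span of the bidisc. Elements of that span are
  finite sums of products of a function of z1 and a function of z2, while the poles of this
  determinant couple the variables. Quotients of span elements allow such coupling, and this is the
  gap between the two notions. Slicing makes the obstruction visible without any change of
  variables. The denominator of h comes from the ansatz w1 * (s + t * A) - t. At the centre of the
  slice over b, the relation |A|^2 = (|A|^2 - 1) + 1 cancels the terms in |A|^2 and leaves (3 s + t
  - s * cnj b) / (|A|^2 - 1), which is antiholomorphic in b up to a factor that the area of the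
  slice absorbs. So s = x and t = 1 - 3 x produce the disc kernel at x. As x is a free parameter,
  the evaluation at x can avoid any finite set of nodes.\<close>

lemma distr_lborel_basis_isomorphism:
  fixes T :: "'a::euclidean_space \<Rightarrow> 'b::euclidean_space"
  assumes lin: "linear T" and bij: "bij_betw T Basis Basis"
  shows "distr lborel lborel T = lborel"
proof (rule sym, rule lborel_eqI)
  have Tm [measurable]: "T \<in> borel \<rightarrow>\<^sub>M borel"
    using lin by (intro borel_measurable_continuous_onI linear_continuous_on linear_conv_bounded_linear[THEN iffD1])
  have inner: "T x \<bullet> T i = x \<bullet> i" if i: "i \<in> Basis" for x i
  proof -
    have "T x = T (\<Sum>j\<in>Basis. (x \<bullet> j) *\<^sub>R j)" by (simp add: euclidean_representation)
    also have "\<dots> = (\<Sum>j\<in>Basis. (x \<bullet> j) *\<^sub>R T j)" by (simp add: linear_sum[OF lin] linear_scale[OF lin])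
    finally have "T x \<bullet> T i = (\<Sum>j\<in>Basis. (x \<bullet> j) * (T j \<bullet> T i))" by (simp add: inner_sum_left)
    also have "\<dots> = (\<Sum>j\<in>Basis. if j = i then x \<bullet> i else 0)"
    proof (rule sum.cong[OF refl])
      fix j :: 'a assume "j \<in> Basis"
      moreover from this have "T j = T i \<longleftrightarrow> j = i" "T j \<in> Basis" "T i \<in> Basis"
        using bij i by (auto simp: bij_betw_def inj_on_def)
      ultimately show "(x \<bullet> j) * (T j \<bullet> T i) = (if j = i then x \<bullet> i else 0)"
        by (auto simp: inner_Basis)
    qed
    finally show ?thesis using i by simp
  qed
  fix l u :: 'b
  assume le: "\<And>b. b \<in> Basis \<Longrightarrow> l \<bullet> b \<le> u \<bullet> b"
  have Bim: "Basis = T ` Basis" using bij by (simp add: bij_betw_def)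
  \<comment> \<open>Since T permutes coordinates, the preimage of a box is the box with permuted
    sides, whose volume is the same product.\<close>
  let ?l = "(\<Sum>i\<in>Basis. (l \<bullet> T i) *\<^sub>R i)" and ?u = "(\<Sum>i\<in>Basis. (u \<bullet> T i) *\<^sub>R i)"
  have vim: "T -` box l u = box ?l ?u"
    by (subst (2) box_def, auto simp: mem_box Bim inner)
  have "emeasure (distr lborel lborel T) (box l u) = emeasure lborel (box ?l ?u)"
    by (subst emeasure_distr) (simp_all add: vim)
  also have "\<dots> = (\<Prod>i\<in>Basis. (?u - ?l) \<bullet> i)"
    using le Bim by (subst emeasure_lborel_box) auto
  also have "(\<Prod>i\<in>Basis. (?u - ?l) \<bullet> i) = (\<Prod>i\<in>Basis. (u - l) \<bullet> T i)"
    by (rule prod.cong) (auto simp: inner_diff_left)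
  also have "\<dots> = (\<Prod>b\<in>Basis. (u - l) \<bullet> b)"
    by (rule prod.reindex_bij_betw[OF bij])
  finally show "emeasure (distr lborel lborel T) (box l u) = (\<Prod>b\<in>Basis. (u - l) \<bullet> b)" .
qed simp

text \<open>Fubini's theorem speaks of pairs, the domains of vectors. The pairing map sends one
  Euclidean basis onto the other, so integrals can be moved between the two.\<close>

lemma distr_lborel_vector_2:
  "distr lborel lborel (\<lambda>(a, b). vector [a, b] :: complex ^ 2) = lborel"
proof (rule distr_lborel_basis_isomorphism)
  show "linear (\<lambda>(a, b). vector [a, b] :: complex ^ 2)"
    by (rule linearI) (auto simp: vec_eq_iff forall_2)
  have ax: "vector [u, 0] = (axis 1 u :: complex ^ 2)" "vector [0, u] = (axis 2 u :: complex ^ 2)" for u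
    by (auto simp: vec_eq_iff forall_2 axis_def)
  have "(\<lambda>(a, b). vector [a, b] :: complex ^ 2) ` Basis = Basis"
    unfolding Basis_prod_def Basis_vec_def
    by (auto simp: image_Un image_image ax UNIV_2)
  moreover have "inj_on (\<lambda>(a, b). vector [a, b] :: complex ^ 2) Basis"
    by (auto simp: inj_on_def vec_eq_iff forall_2)
  ultimately show "bij_betw (\<lambda>(a, b). vector [a, b] :: complex ^ 2) Basis Basis"
    by (simp add: bij_betw_def)
qed

text \<open>Boxes determine the measure, and the preimage of a box under R is its image under the
  orthogonal map \<open>inv R\<close>, which has the same volume.\<close>

lemma distr_lborel_orthogonal:
  fixes R :: "real ^ 'n::{finite,wellorder} \<Rightarrow> real ^ 'n::_"
  assumes R: "orthogonal_transformation R"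
  shows "distr lborel lborel R = lborel"
proof (rule sym, rule lborel_eqI)
  have [measurable]: "R \<in> borel \<rightarrow>\<^sub>M borel"
    using R by (intro borel_measurable_continuous_onI linear_continuous_on linear_conv_bounded_linear[THEN iffD1])
      (simp add: orthogonal_transformation_linear)
  fix l u :: "real ^ 'n::_"
  assume le: "\<And>b. b \<in> Basis \<Longrightarrow> l \<bullet> b \<le> u \<bullet> b"
  have bj: "bij R" using R by (rule orthogonal_transformation_bij)
  have iR: "orthogonal_transformation (inv R)" using R by (rule orthogonal_transformation_inv)
  have vim: "R -` box l u = inv R ` box l u" using bj by (rule bij_vimage_eq_inv_image)
  have meas: "inv R ` box l u \<in> lmeasurable"
    by (rule measurable_orthogonal_image[OF iR]) simp
  have bor: "inv R ` box l u \<in> sets borel"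
    unfolding vim[symmetric] by (metis \<open>R \<in> borel \<rightarrow>\<^sub>M borel\<close> borel_open measurable_sets_borel open_box)
  have "emeasure (distr lborel lborel R) (box l u) = emeasure lborel (inv R ` box l u)"
    by (subst emeasure_distr) (simp_all add: vim)
  also have "\<dots> = emeasure lebesgue (inv R ` box l u)"
    using bor by simp
  also have "\<dots> = ennreal (measure lebesgue (inv R ` box l u))"
    using meas by (simp add: emeasure_eq_measure2)
  also have "\<dots> = ennreal (measure lebesgue (box l u))"
    by (subst measure_orthogonal_image[OF iR]) auto
  also have "\<dots> = (\<Prod>b\<in>Basis. (u - l) \<bullet> b)"
    using le by simp
  finally show "emeasure (distr lborel lborel R) (box l u) = (\<Prod>b\<in>Basis. (u - l) \<bullet> b)" .
qed simp

text \<open>In the real coordinates given by V, multiplication by c is the matrix R with entries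
  from \<open>Re c\<close> and \<open>Im c\<close>; it is orthogonal because |c| = 1.\<close>

lemma distr_lborel_complex_rotation:
  fixes c :: complex
  assumes c: "norm c = 1"
  shows "distr lborel lborel (\<lambda>w. c * w) = lborel"
proof -
  define V :: "real ^ 2 \<Rightarrow> complex" where "V x = Complex (x $ 1) (x $ 2)" for x
  define R :: "real ^ 2 \<Rightarrow> real ^ 2" where
    "R x = vector [Re c * x $ 1 - Im c * x $ 2, Re c * x $ 2 + Im c * x $ 1]" for x
  have linV: "linear V" by (rule linearI) (auto simp: V_def complex_eq_iff)
  have "V ` Basis = Basis"
    unfolding Basis_complex_def Basis_vec_def
    by (auto simp: UNIV_2 V_def axis_def complex_eq_iff image_Un)
  moreover have "inj V" by (auto simp: inj_on_def V_def vec_eq_iff forall_2)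
  ultimately have "bij_betw V Basis Basis" unfolding bij_betw_def using inj_on_subset by blast
  then have V: "distr lborel lborel V = lborel" using linV by (rule distr_lborel_basis_isomorphism[rotated])
  have linR: "linear R" by (rule linearI) (auto simp: R_def vec_eq_iff forall_2 algebra_simps)
  have c2: "Re c * Re c + Im c * Im c = 1" using c by (simp add: cmod_def power2_eq_square)
  have "R v \<bullet> R w = v \<bullet> w" for v w
  proof -
    have "R v \<bullet> R w = (Re c * Re c + Im c * Im c) * (v $ 1 * w $ 1 + v $ 2 * w $ 2)"
      by (simp add: R_def inner_vec_def sum_2 algebra_simps)
    then show ?thesis by (simp add: c2 inner_vec_def sum_2)
  qed
  then have R: "distr lborel lborel R = lborel"
    using linR by (intro distr_lborel_orthogonal) (simp add: orthogonal_transformation_def)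
  have [measurable]: "V \<in> borel \<rightarrow>\<^sub>M borel" "R \<in> borel \<rightarrow>\<^sub>M borel"
    using linV linR by (auto intro!: borel_measurable_continuous_onI linear_continuous_on simp: linear_conv_bounded_linear)
  have eq: "(\<lambda>w. c * w) \<circ> V = V \<circ> R"
    by (auto simp: fun_eq_iff V_def R_def complex_eq_iff)
  have "distr lborel lborel (\<lambda>w. c * w) = distr (distr lborel lborel V) lborel (\<lambda>w. c * w)"
    by (simp add: V)
  also have "\<dots> = distr lborel lborel ((\<lambda>w. c * w) \<circ> V)" by (rule distr_distr) simp_all
  also have "\<dots> = distr (distr lborel lborel R) lborel V" unfolding eq by (rule distr_distr[symmetric]) simp_all
  finally show ?thesis by (simp add: R V)
qed

text \<open>Each rotation preserves the integral, hence so does the average over all angles; Fubini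
  moves this average inside. Together with the radial integral below it takes the place of polar
  coordinates.\<close>

lemma integral_rotation_average:
  fixes F :: "complex \<Rightarrow> complex"
  assumes F: "integrable lborel F"
  shows "(LINT w|lborel. F w) = (LINT w|lborel. (LINT t:{0..1}|lborel. F (cis (2 * pi * t) * w)))"
proof -
  let ?G = "\<lambda>t w. indicator {0..1::real} t *\<^sub>R F (cis (2 * pi * t) * w)"
  have [measurable]: "F \<in> borel_measurable borel" using F by (simp add: borel_measurable_integrable)
  have cis: "continuous_on UNIV (\<lambda>t. cis (2 * pi * t))"
    unfolding cis_conv_exp by (intro continuous_intros)
  then have [measurable]: "(\<lambda>t. cis (2 * pi * t)) \<in> borel_measurable borel"
    by (rule borel_measurable_continuous_onI)
  have Gm: "case_prod ?G \<in> borel_measurable (lborel \<Otimes>\<^sub>M lborel)"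
    by measurable
  have rot: "distr lborel lborel (\<lambda>w. cis (2 * pi * t) * w) = lborel" for t
    by (rule distr_lborel_complex_rotation) simp
  have int: "integrable lborel (\<lambda>w. F (cis (2 * pi * t) * w))" for t
    by (rule integrable_distr[where M = lborel and M' = lborel]) (simp_all add: rot F)
  have eq: "(LINT w|lborel. f (cis (2 * pi * t) * w)) = (LINT w|lborel. f w)"
    if [measurable]: "f \<in> borel_measurable borel" for t and f :: "complex \<Rightarrow> 'b::{banach,second_countable_topology}"
    by (subst (2) rot[of t, symmetric], subst integral_distr) simp_all
  have "integrable (lborel \<Otimes>\<^sub>M lborel) (case_prod ?G)"
  proof (rule lborel_pair.Fubini_integrable[OF Gm])
    have n: "(LINT w|lborel. norm (?G t w)) = indicator {0..1} t *\<^sub>R (LINT w|lborel. norm (F w))" for t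
      using eq[of "\<lambda>w. norm (F w)" t] by (simp add: indicator_def)
    show "integrable lborel (\<lambda>t. (LINT w|lborel. norm (case (t, w) of (t, w) \<Rightarrow> ?G t w)))"
      unfolding prod.case n by (rule integrable_scaleR_left) (simp add: integrable_indicator_iff)
    show "AE t in lborel. integrable lborel (\<lambda>w. case (t, w) of (t, w) \<Rightarrow> ?G t w)"
      using int by simp
  qed
  then have "(LINT w|lborel. (LINT t|lborel. ?G t w)) = (LINT t|lborel. (LINT w|lborel. ?G t w))"
    by (rule lborel_pair.Fubini_integral)
  also have "\<dots> = (LINT t|lborel. indicator {0..1::real} t *\<^sub>R (LINT w|lborel. F w))"
    by (simp add: eq)
  also have "\<dots> = (LINT w|lborel. F w)" by (simp add: integrable_indicator_iff)
  finally show ?thesis by (simp add: set_lebesgue_integral_def)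
qed

lemma emeasure_lborel_complex_ball:
  "r \<ge> 0 \<Longrightarrow> emeasure lborel (ball (c::complex) r) = ennreal (pi * r ^ 2)"
  "r \<ge> 0 \<Longrightarrow> emeasure lborel (cball (c::complex) r) = ennreal (pi * r ^ 2)"
  by (simp_all add: emeasure_ball emeasure_cball unit_ball_vol_2)

text \<open>The part of the disc where |w|^2 > x is an annulus of area pi * (1 - x) for 0 \<le> x <
  1, and half-lines determine the measure. The square of the radius is used because its density is
  constant.\<close>

lemma distr_unit_disc_norm_square:
  "distr (density lborel (indicator (ball (0::complex) 1))) borel (\<lambda>w. (norm w)\<^sup>2)
     = density lborel (\<lambda>s. ennreal pi * indicator {0..1::real} s)" (is "?M = ?N")
proof (rule measure_eqI_lessThan)
  have M: "emeasure ?M {x<..} = emeasure lborel {w \<in> ball 0 1. x < (norm (w::complex))\<^sup>2}" for x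
  proof -
    have [measurable]: "(\<lambda>w::complex. (norm w)\<^sup>2) -` {x<..} \<in> sets borel"
      by (rule measurable_sets_borel[where M = borel]) simp_all
    have "emeasure ?M {x<..} = emeasure (density lborel (indicator (ball (0::complex) 1))) ((\<lambda>w. (norm w)\<^sup>2) -` {x<..})"
      by (subst emeasure_distr) simp_all
    also have "\<dots> = (\<integral>\<^sup>+w. indicator (ball (0::complex) 1) w * indicator ((\<lambda>w. (norm w)\<^sup>2) -` {x<..}) w \<partial>lborel)"
      by (rule emeasure_density) (simp_all add: borel_measurable_indicator)
    also have "\<dots> = (\<integral>\<^sup>+w. indicator {w \<in> ball 0 1. x < (norm (w::complex))\<^sup>2} w \<partial>lborel)"
      by (rule nn_integral_cong) (auto simp: indicator_def)
    also have "\<dots> = emeasure lborel {w \<in> ball 0 1. x < (norm (w::complex))\<^sup>2}"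
      by (rule nn_integral_indicator) simp
    finally show ?thesis .
  qed
  have N: "emeasure ?N {x<..} = ennreal pi * emeasure lborel ({0..1} \<inter> {x<..})" for x :: real
  proof -
    have "emeasure ?N {x<..} = (\<integral>\<^sup>+s. ennreal pi * indicator ({0..1} \<inter> {x<..}) s \<partial>lborel)"
      by (subst emeasure_density) (auto intro!: nn_integral_cong simp: indicator_def)
    then show ?thesis by (simp add: nn_integral_cmult_indicator)
  qed
  show "emeasure ?M {x<..} = emeasure ?N {x<..}" for x
  proof -
    consider "x < 0" | "0 \<le> x" "x < 1" | "1 \<le> x" by linarith
    then show ?thesis
    proof cases
      case 1
      then have "{w \<in> ball 0 1. x < (norm (w::complex))\<^sup>2} = ball 0 1"
        using zero_le_power2 less_le_trans by blast
      moreover have "{0..1} \<inter> {x<..} = {0..1}" using 1 by auto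
      ultimately show ?thesis unfolding M N by (simp add: emeasure_lborel_complex_ball)
    next
      case 2
      have eq: "x < (norm (w::complex))\<^sup>2 \<longleftrightarrow> \<not> norm w \<le> sqrt x" for w
        using 2 by (simp add: not_le real_less_rsqrt real_sqrt_less_iff) (metis abs_norm_cancel real_sqrt_abs real_sqrt_less_iff)
      have "{w \<in> ball 0 1. x < (norm (w::complex))\<^sup>2} = ball 0 1 - cball 0 (sqrt x)"
        unfolding eq by auto
      moreover have "sqrt x < 1" using 2 by simp
      then have "cball 0 (sqrt x) \<subseteq> ball (0::complex) 1"
        by (meson mem_ball_0 mem_cball_0 le_less_trans subsetI)
      ultimately have "emeasure lborel {w \<in> ball 0 1. x < (norm (w::complex))\<^sup>2} = ennreal pi - ennreal (pi * x)"
        using 2 by (simp add: emeasure_Diff emeasure_lborel_complex_ball)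
      also have "\<dots> = ennreal (pi * (1 - x))"
        using 2 by (simp add: ennreal_minus algebra_simps)
      also have "\<dots> = ennreal pi * emeasure lborel ({0..1} \<inter> {x<..})"
      proof -
        have "{0..1} \<inter> {x<..} = {x<..1}" using 2 by auto
        then show ?thesis using 2 by (simp add: ennreal_mult)
      qed
      finally show ?thesis unfolding M N .
    next
      case 3
      have a: "{w \<in> ball 0 1. x < (norm (w::complex))\<^sup>2} = {}"
        using 3 by (auto simp: not_less power_le_one_iff intro: order.trans[OF _ 3])
      have b: "{0..1} \<inter> {x<..} = {}" using 3 by auto
      show ?thesis unfolding M N a b by simp
    qed
  qed
  show "emeasure ?M {x<..} < \<infinity>" for x
  proof -
    have "emeasure ?M {x<..} \<le> emeasure lborel (ball (0::complex) 1)"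
      unfolding M by (rule emeasure_mono) auto
    also have "\<dots> < \<infinity>" by (simp add: emeasure_lborel_complex_ball)
    finally show ?thesis .
  qed
qed simp_all

text \<open>Polar coordinates for radial integrands, with s = r^2 absorbing the Jacobian factor
  r.\<close>

lemma integral_unit_disc_radial:
  fixes \<phi> :: "real \<Rightarrow> complex"
  assumes [measurable]: "\<phi> \<in> borel_measurable borel"
  shows "(LINT w:ball (0::complex) 1|lborel. \<phi> ((norm w)\<^sup>2)) = pi * (LINT s:{0..1}|lborel. \<phi> s)"
proof -
  have "(LINT w:ball (0::complex) 1|lborel. \<phi> ((norm w)\<^sup>2))
      = (LINT w|density lborel (indicator (ball (0::complex) 1)). \<phi> ((norm w)\<^sup>2))"
    unfolding set_lebesgue_integral_def
    by (subst integral_density[where g = "indicator (ball 0 1)", symmetric])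
       (simp_all add: ennreal_indicator borel_measurable_indicator)
  also have "\<dots> = (LINT s|density lborel (\<lambda>s. ennreal (pi * indicator {0..1::real} s)). \<phi> s)"
    unfolding ennreal_mult[OF pi_ge_zero indicator_pos_le] ennreal_indicator
      distr_unit_disc_norm_square[symmetric]
    by (subst integral_distr) simp_all
  also have "\<dots> = (LINT s|lborel. (pi * indicator {0..1::real} s) *\<^sub>R \<phi> s)"
    by (rule integral_density) simp_all
  also have "\<dots> = pi * (LINT s:{0..1}|lborel. \<phi> s)"
    by (simp add: set_lebesgue_integral_def scaleR_conv_of_real mult.assoc)
  finally show ?thesis .
qed

section \<open>The Bergman kernel of the disc\<close>

text \<open>On the circle of radius \<open>r\<close> we have \<open>cnj w = r\<^sup>2 / w\<close>, so Cauchy's formula applies.\<close>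
lemma circle_average_kernel_real:
  fixes g :: "complex \<Rightarrow> complex"
  assumes g: "g holomorphic_on ball 0 1" and z: "norm z < 1" and r: "0 < r" "r < 1"
  shows "((\<lambda>t. g (cis (2 * pi * t) * of_real r) / (1 - z * cnj (cis (2 * pi * t) * of_real r))\<^sup>2)
            has_integral deriv (\<lambda>\<zeta>. \<zeta> * g \<zeta>) (z * of_real (r\<^sup>2))) {0..1}"
proof -
  let ?f = "\<lambda>\<zeta>. \<zeta> * g \<zeta>" and ?\<gamma> = "\<lambda>t. cis (2 * pi * t) * of_real r"
  have f: "?f holomorphic_on ball 0 1" using g by (intro holomorphic_intros)
  have sub: "cball 0 r \<subseteq> ball (0::complex) 1" "ball 0 r \<subseteq> ball (0::complex) 1" using r by auto
  have zr: "norm (z * of_real (r\<^sup>2)) < r"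
  proof -
    have "norm z * r\<^sup>2 \<le> 1 * r\<^sup>2" using z by (intro mult_right_mono) auto
    also have "\<dots> < r" using r by (simp add: power2_eq_square)
    finally show ?thesis by (simp add: norm_mult norm_power)
  qed
  \<comment> \<open>The extra factor in \<zeta> * g \<zeta>, together with the one in d\<zeta> = 2
    pi i \<zeta> dt, cancels the square of the path that the denominator contributes.\<close>
  have "((\<lambda>u. ?f u / (u - z * of_real (r\<^sup>2)) ^ Suc 1) has_contour_integral
          (2 * pi * \<i>) / fact 1 * (deriv ^^ 1) ?f (z * of_real (r\<^sup>2))) (circlepath 0 r)"
    using zr by (intro Cauchy_has_contour_integral_higher_derivative_circlepath
        holomorphic_on_imp_continuous_on holomorphic_on_subset[OF f] sub) auto
  then have "((\<lambda>t. ?f (circlepath 0 r t) / (circlepath 0 r t - z * of_real (r\<^sup>2))\<^sup>2 *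
                 vector_derivative (circlepath 0 r) (at t within {0..1}))
          has_integral 2 * pi * \<i> * deriv ?f (z * of_real (r\<^sup>2))) {0..1}"
    by (simp add: has_contour_integral_def numeral_2_eq_2)
  then have "((\<lambda>t. 2 * pi * \<i> * (g (?\<gamma> t) / (1 - z * cnj (?\<gamma> t))\<^sup>2))
          has_integral 2 * pi * \<i> * deriv ?f (z * of_real (r\<^sup>2))) {0..1}"
  proof (rule has_integral_eq[rotated])
    fix t :: real assume t: "t \<in> {0..1}"
    have \<gamma>: "circlepath 0 r t = ?\<gamma> t"
      by (simp add: circlepath cis_conv_exp mult_ac)
    have nz: "?\<gamma> t \<noteq> 0" using r by (simp add: cis_neq_zero)
    have "?\<gamma> t * cnj (?\<gamma> t) = of_real (r\<^sup>2)"
      unfolding complex_norm_square[symmetric] by (simp add: norm_mult)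
    then have "?\<gamma> t - z * of_real (r\<^sup>2) = ?\<gamma> t * (1 - z * cnj (?\<gamma> t))"
      by (simp add: algebra_simps)
    moreover have "vector_derivative (circlepath 0 r) (at t within {0..1}) = 2 * pi * \<i> * ?\<gamma> t"
      using t by (simp add: vector_derivative_circlepath01 cis_conv_exp mult_ac)
    ultimately have "?f (circlepath 0 r t) / (circlepath 0 r t - z * of_real (r\<^sup>2))\<^sup>2 *
                 vector_derivative (circlepath 0 r) (at t within {0..1})
        = (?\<gamma> t)\<^sup>2 / (?\<gamma> t)\<^sup>2 * (2 * pi * \<i> * (g (?\<gamma> t) / (1 - z * cnj (?\<gamma> t))\<^sup>2))"
      unfolding \<gamma> by (simp add: power_mult_distrib power2_eq_square)
    then show "?f (circlepath 0 r t) / (circlepath 0 r t - z * of_real (r\<^sup>2))\<^sup>2 *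
                 vector_derivative (circlepath 0 r) (at t within {0..1})
        = 2 * pi * \<i> * (g (?\<gamma> t) / (1 - z * cnj (?\<gamma> t))\<^sup>2)"
      using nz by simp
  qed
  then have "((\<lambda>t. inverse (2 * pi * \<i>) * (2 * pi * \<i> * (g (?\<gamma> t) / (1 - z * cnj (?\<gamma> t))\<^sup>2)))
          has_integral inverse (2 * pi * \<i>) * (2 * pi * \<i> * deriv ?f (z * of_real (r\<^sup>2)))) {0..1}"
    by (rule has_integral_mult_right)
  then show ?thesis by (simp add: field_simps)
qed

lemma norm_one_minus_mult_cnj_pos:
  assumes "norm (z::complex) < 1" "norm w < 1" shows "1 - z * cnj w \<noteq> 0" "1 - cnj w * z \<noteq> 0"
proof -
  have "norm (z * cnj w) < 1 * 1"
    unfolding norm_mult using assms by (intro mult_strict_mono') auto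
  then show "1 - z * cnj w \<noteq> 0" "1 - cnj w * z \<noteq> 0" by (auto simp: mult.commute)
qed

text \<open>Writing w = u * |w| with |u| = 1 and replacing g by its rotation g (u * _) and z by z *
  cnj u reduces the claim to a circle parametrised from a positive real. The centre w = 0 has no
  such u and is treated apart.\<close>

lemma circle_average_kernel:
  fixes g :: "complex \<Rightarrow> complex"
  assumes g: "g holomorphic_on ball 0 1" and z: "norm z < 1" and w: "norm w < 1"
  shows "(LINT t:{0..1}|lborel. g (cis (2 * pi * t) * w) / (1 - z * cnj (cis (2 * pi * t) * w))\<^sup>2)
          = deriv (\<lambda>\<zeta>. \<zeta> * g \<zeta>) (z * of_real ((norm w)\<^sup>2))"
proof (cases "w = 0")
  case True
  have "((\<lambda>\<zeta>. \<zeta> * g \<zeta>) has_field_derivative 0 * deriv g 0 + 1 * g 0) (at 0)"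
    by (rule DERIV_mult') (auto intro!: holomorphic_derivI[OF g] derivative_eq_intros)
  then have "deriv (\<lambda>\<zeta>. \<zeta> * g \<zeta>) 0 = g 0" by (simp add: DERIV_imp_deriv)
  then show ?thesis using True by (simp add: set_lebesgue_integral_def)
next
  case False
  define r where "r = norm w"
  define u where "u = w / of_real r"
  have r: "0 < r" "r < 1" using False w by (auto simp: r_def)
  have u12: "norm u = 1" "w = u * of_real r" using r by (auto simp: u_def r_def norm_divide)
  then have "u * cnj u = 1" unfolding complex_norm_square[symmetric] by simp
  note u = u12 this
  let ?f = "\<lambda>\<zeta>. \<zeta> * g \<zeta>"
  let ?F = "\<lambda>t. g (cis (2 * pi * t) * w) / (1 - z * cnj (cis (2 * pi * t) * w))\<^sup>2"
  have gu: "(\<lambda>\<zeta>. g (u * \<zeta>)) holomorphic_on ball 0 1"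
    using u by (intro holomorphic_on_compose_gen[OF _ g, unfolded o_def]) (auto intro!: holomorphic_intros simp: norm_mult)
  have zu: "norm (z * cnj u) < 1" using z u by (simp add: norm_mult)
  have zr: "norm (z * of_real (r\<^sup>2)) < 1"
  proof -
    have "norm z * r\<^sup>2 \<le> norm z * 1" using r by (intro mult_left_mono) (auto simp: power_le_one)
    then show ?thesis using z by (simp add: norm_mult norm_power)
  qed
  \<comment> \<open>The rotated function \<zeta> * g (u * \<zeta>) equals cnj u * f (u * \<zeta>)
    for f \<zeta> = \<zeta> * g \<zeta>; its derivative gains the factor u, and cnj u * u =
    1.\<close>
  have "((\<lambda>\<zeta>. cnj u * ?f (u * \<zeta>)) has_field_derivative cnj u * (deriv ?f (z * of_real (r\<^sup>2)) * u)) (at (z * cnj u * of_real (r\<^sup>2)))"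
  proof (rule DERIV_cmult, rule DERIV_chain2[where f = ?f])
    have "u * (z * cnj u * of_real (r\<^sup>2)) = (u * cnj u) * (z * of_real (r\<^sup>2))" by simp
    then have e: "u * (z * cnj u * of_real (r\<^sup>2)) = z * of_real (r\<^sup>2)" using u by simp
    show "(?f has_field_derivative deriv ?f (z * of_real (r\<^sup>2))) (at (u * (z * cnj u * of_real (r\<^sup>2))))"
      unfolding e using zr g by (intro holomorphic_derivI[where S = "ball 0 1"] holomorphic_intros) auto
    show "((\<lambda>\<zeta>. u * \<zeta>) has_field_derivative u) (at (z * cnj u * of_real (r\<^sup>2)))"
      by (auto intro!: derivative_eq_intros)
  qed
  moreover have "(\<lambda>\<zeta>. cnj u * ?f (u * \<zeta>)) = (\<lambda>\<zeta>. \<zeta> * g (u * \<zeta>))"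
    using u by (auto simp: fun_eq_iff mult_ac)
  moreover have "cnj u * (deriv ?f (z * of_real (r\<^sup>2)) * u) = deriv ?f (z * of_real (r\<^sup>2))"
    using u(3) by (metis mult.assoc mult.commute mult_1)
  ultimately have d: "deriv (\<lambda>\<zeta>. \<zeta> * g (u * \<zeta>)) (z * cnj u * of_real (r\<^sup>2)) = deriv ?f (z * of_real (r\<^sup>2))"
    using DERIV_imp_deriv by metis
  have hi: "(?F has_integral deriv ?f (z * of_real (r\<^sup>2))) {0..1}"
    using circle_average_kernel_real[OF gu zu r] unfolding d by (simp add: u(2) mult_ac)
  have n: "norm (cis (2 * pi * t) * w) < 1" for t using w by (simp add: norm_mult)
  have "continuous_on {0..1} ?F"
  proof (rule continuous_on_divide)
    have c: "continuous_on {0..1} (\<lambda>t. cis (2 * pi * t) * w)"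
      unfolding cis_conv_exp by (intro continuous_intros)
    show "continuous_on {0..1} (\<lambda>t. g (cis (2 * pi * t) * w))"
      using n by (intro continuous_on_compose2[OF holomorphic_on_imp_continuous_on[OF g] c]) auto
    show "continuous_on {0..1} (\<lambda>t. (1 - z * cnj (cis (2 * pi * t) * w))\<^sup>2)"
      by (intro continuous_intros c)
    show "\<forall>t\<in>{0..1}. (1 - z * cnj (cis (2 * pi * t) * w))\<^sup>2 \<noteq> 0"
      using norm_one_minus_mult_cnj_pos[OF z n] by simp
  qed
  then have "set_integrable lborel {0..1} ?F"
    unfolding set_integrable_def by (intro borel_integrable_compact) auto
  then have "(LINT t:{0..1}|lborel. ?F t) = integral {0..1} ?F"
    by (rule set_borel_integral_eq_integral(2))
  also have "\<dots> = deriv ?f (z * of_real (r\<^sup>2))" using hi by (rule integral_unique)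
  finally show ?thesis unfolding r_def .
qed

text \<open>Circle averages turn the integral into that of H over [0, 1] in the variable s = |w|^2.
  The chain rule identifies H s with the derivative of s * g (z * s), so the integral is g z.
  Integrability is assumed for the product with the kernel because this is what Fubini supplies on
  slices.\<close>

lemma disc_kernel_reproducing:
  fixes g :: "complex \<Rightarrow> complex"
  assumes g: "g holomorphic_on ball 0 1" and z: "norm z < 1"
    and int: "set_integrable lborel (ball 0 1) (\<lambda>w. g w / (1 - z * cnj w)\<^sup>2)"
  shows "(LINT w:ball 0 1|lborel. g w / (1 - z * cnj w)\<^sup>2) = pi * g z"
proof -
  let ?F = "\<lambda>w. g w / (1 - z * cnj w)\<^sup>2"
  define H where "H s = deriv (\<lambda>\<zeta>. \<zeta> * g \<zeta>) (z * of_real s)" for s :: real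
  \<comment> \<open>The radial integral asks for measurability on the whole line, whereas continuity
    of H is established only on [0, 1].\<close>
  define \<phi> where "\<phi> s = indicator {0..1} s *\<^sub>R H s" for s
  have f: "(\<lambda>\<zeta>. \<zeta> * g \<zeta>) holomorphic_on ball 0 1" using g by (intro holomorphic_intros)
  have zs: "norm (z * of_real s) < 1" if "s \<in> {0..1}" for s :: real
  proof -
    have "norm z * s \<le> norm z * 1" using that by (intro mult_left_mono) auto
    then show ?thesis using z that by (simp add: norm_mult)
  qed
  have cH: "continuous_on {0..1} H" unfolding H_def
    using zs by (intro continuous_on_compose2[OF holomorphic_on_imp_continuous_on[OF holomorphic_deriv[OF f]]] continuous_intros) auto
  have \<phi>[measurable]: "\<phi> \<in> borel_measurable borel"
    unfolding \<phi>_def using cH by (intro borel_measurable_continuous_on_indicator) auto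
  have F: "integrable lborel (\<lambda>w. indicator (ball 0 1) w *\<^sub>R ?F w)"
    using int by (simp add: set_integrable_def)
  have "(LINT w:ball 0 1|lborel. ?F w) = (LINT w|lborel. indicator (ball 0 1) w *\<^sub>R ?F w)"
    by (simp add: set_lebesgue_integral_def)
  also have "\<dots> = (LINT w|lborel. (LINT t:{0..1}|lborel. indicator (ball 0 1) (cis (2 * pi * t) * w) *\<^sub>R ?F (cis (2 * pi * t) * w)))"
    by (rule integral_rotation_average[OF F])
  also have "\<dots> = (LINT w:ball (0::complex) 1|lborel. \<phi> ((norm w)\<^sup>2))"
    unfolding set_lebesgue_integral_def[of lborel "ball 0 1"]
  proof (rule Bochner_Integration.integral_cong[OF refl])
    fix w :: complex
    have b: "cis x * w \<in> ball 0 1 \<longleftrightarrow> w \<in> ball 0 1" for x by (simp add: norm_mult)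
    show "(LINT t:{0..1}|lborel. indicator (ball 0 1) (cis (2 * pi * t) * w) *\<^sub>R ?F (cis (2 * pi * t) * w))
        = indicator (ball 0 1) w *\<^sub>R \<phi> ((norm w)\<^sup>2)"
    proof (cases "w \<in> ball 0 1")
      case True
      then have "(norm w)\<^sup>2 \<in> {0..1}" by (auto simp: power_le_one)
      then show ?thesis using circle_average_kernel[OF g z, of w] True b
        by (simp add: indicator_def \<phi>_def H_def)
    next
      case False
      then show ?thesis using b by (simp add: indicator_def set_lebesgue_integral_def)
    qed
  qed
  also have "\<dots> = pi * (LINT s:{0..1}|lborel. \<phi> s)" by (rule integral_unit_disc_radial[OF \<phi>])
  also have "(LINT s:{0..1}|lborel. \<phi> s) = (LINT s:{0..1}|lborel. H s)"
    by (rule set_lebesgue_integral_cong) (auto simp: \<phi>_def)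
  also have "\<dots> = integral {0..1} H"
    using cH by (intro set_borel_integral_eq_integral(2)) (auto simp: set_integrable_def intro: borel_integrable_compact)
  also have "\<dots> = g z"
  proof (rule integral_unique)
    have "(H has_integral of_real 1 * g (z * of_real 1) - of_real 0 * g (z * of_real 0)) {0..1}"
    proof (rule fundamental_theorem_of_calculus)
      fix s :: real assume s: "s \<in> {0..1}"
      have dg: "(g has_field_derivative deriv g (z * of_real s)) (at (z * of_real s))"
        using zs[OF s] by (intro holomorphic_derivI[OF g]) auto
      have "((\<lambda>\<zeta>. \<zeta> * g \<zeta>) has_field_derivative z * of_real s * deriv g (z * of_real s) + 1 * g (z * of_real s)) (at (z * of_real s))"
        by (rule DERIV_mult') (auto intro: dg)
      then have Hs: "H s = z * of_real s * deriv g (z * of_real s) + g (z * of_real s)"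
        unfolding H_def by (simp add: DERIV_imp_deriv)
      have "((\<lambda>x. x * g (z * x)) has_field_derivative of_real s * (deriv g (z * of_real s) * z) + 1 * g (z * of_real s)) (at (of_real s))"
        by (rule DERIV_mult', simp, rule DERIV_chain2[where f = g]) (auto intro!: derivative_eq_intros dg)
      then have "((\<lambda>s. of_real s * g (z * of_real s)) has_vector_derivative of_real s * (deriv g (z * of_real s) * z) + 1 * g (z * of_real s)) (at s)"
        by (rule has_vector_derivative_real_field)
      then show "((\<lambda>s. of_real s * g (z * of_real s)) has_vector_derivative H s) (at s within {0..1})"
        unfolding Hs by (simp add: has_vector_derivative_at_within mult_ac)
    qed simp
    then show "(H has_integral g z) {0..1}" by simp
  qed
  finally show ?thesis .
qed

text \<open>At z = 0 the disc kernel is constant, so the reproducing formula becomes the area mean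
  value property; scaling and translation carry it to an arbitrary disc.\<close>

lemma mean_value_ball:
  fixes g :: "complex \<Rightarrow> complex"
  assumes g: "g holomorphic_on ball c r" and r: "0 < r" and int: "set_integrable lborel (ball c r) g"
  shows "(LINT w:ball c r|lborel. g w) = pi * r\<^sup>2 * g c"
proof -
  let ?T = "\<lambda>x. c + r *\<^sub>R x"
  define G where "G w = indicator (ball c r) w *\<^sub>R g w" for w
  have aff: "(lborel :: complex measure) = density (distr lborel borel ?T) (\<lambda>_. ennreal (r\<^sup>2))"
    using lborel_affine[of r c] r by simp
  have [measurable]: "G \<in> borel_measurable borel"
    using int by (simp add: G_def[abs_def] set_integrable_def borel_measurable_integrable)
  have ball: "?T x \<in> ball c r \<longleftrightarrow> x \<in> ball 0 1" for x using r by (simp add: dist_norm)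
  have ind: "G (?T x) = indicator (ball 0 1) x *\<^sub>R g (?T x)" for x
    using ball[of x] by (simp add: G_def indicator_def)
  have gT: "(\<lambda>x. g (?T x)) holomorphic_on ball 0 1"
    unfolding scaleR_conv_of_real using ball
    by (intro holomorphic_on_compose_gen[OF _ g, unfolded o_def]) (auto intro!: holomorphic_intros simp: scaleR_conv_of_real)
  have "integrable lborel (\<lambda>x. G (?T x))"
  proof -
    have "integrable (density (distr lborel borel ?T) (\<lambda>_. ennreal (r\<^sup>2))) G"
      using int unfolding aff[symmetric] by (simp add: G_def[abs_def] set_integrable_def)
    then have "integrable (distr lborel borel ?T) (\<lambda>w. r\<^sup>2 *\<^sub>R G w)"
      by (subst (asm) integrable_density) simp_all
    then have "integrable lborel (\<lambda>x. r\<^sup>2 *\<^sub>R G (?T x))"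
      by (rule integrable_distr[rotated]) simp
    then have "integrable lborel (\<lambda>x. (1 / r\<^sup>2) *\<^sub>R r\<^sup>2 *\<^sub>R G (?T x))"
      by (rule integrable_scaleR_right)
    then show ?thesis using r by simp
  qed
  then have "(LINT x:ball 0 1|lborel. g (?T x) / (1 - 0 * cnj x)\<^sup>2) = pi * g (?T 0)"
    by (intro disc_kernel_reproducing gT) (simp_all add: set_integrable_def ind)
  then have m: "(LINT x|lborel. G (?T x)) = pi * g c"
    by (simp add: set_lebesgue_integral_def ind)
  have "(LINT w:ball c r|lborel. g w) = (LINT w|density (distr lborel borel ?T) (\<lambda>_. ennreal (r\<^sup>2)). G w)"
    unfolding aff[symmetric] by (simp add: G_def set_lebesgue_integral_def)
  also have "\<dots> = (LINT x|lborel. r\<^sup>2 *\<^sub>R G (?T x))"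
  proof -
    have "(LINT w|density (distr lborel borel ?T) (\<lambda>_. ennreal (r\<^sup>2)). G w)
        = (LINT w|distr lborel borel ?T. r\<^sup>2 *\<^sub>R G w)"
      by (rule integral_density) simp_all
    also have "\<dots> = (LINT x|lborel. r\<^sup>2 *\<^sub>R G (?T x))"
      by (rule integral_distr) simp_all
    finally show ?thesis .
  qed
  also have "\<dots> = r\<^sup>2 *\<^sub>R (pi * g c)"
    unfolding integral_scaleR_right m ..
  finally show ?thesis by (simp add: scaleR_conv_of_real mult_ac)
qed

section \<open>Holomorphic functions of several variables\<close>

lemma vector_2_measurable [measurable]:
  "(\<lambda>(a, b). vector [a, b] :: complex ^ 2) \<in> borel_measurable borel"
proof -
  have "linear (\<lambda>(a, b). vector [a, b] :: complex ^ 2)"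
    by (rule linearI) (auto simp: vec_eq_iff forall_2)
  then show ?thesis
    by (intro borel_measurable_continuous_onI linear_continuous_on) (simp add: linear_conv_bounded_linear)
qed

text \<open>The second coordinate is the outer variable because the slices of the image domain at a
  fixed second coordinate are discs.\<close>

lemma Fubini_vector_2:
  fixes F :: "complex ^ 2 \<Rightarrow> complex"
  assumes F: "integrable lborel F"
  shows "AE b in lborel. integrable lborel (\<lambda>a. F (vector [a, b]))"
    and "integrable lborel (\<lambda>b. (LINT a|lborel. F (vector [a, b])))"
    and "(LINT b|lborel. (LINT a|lborel. F (vector [a, b]))) = (LINT w|lborel. F w)"
proof -
  let ?T = "\<lambda>(a, b). vector [a, b] :: complex ^ 2" and ?G = "\<lambda>a b. F (vector [a, b])"
  have [measurable]: "F \<in> borel_measurable borel" using F by (simp add: borel_measurable_integrable)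
  have "integrable lborel (\<lambda>p. F (?T p))"
    by (rule integrable_distr[where M' = lborel]) (simp_all add: distr_lborel_vector_2 F vector_2_measurable)
  then have G: "integrable (lborel \<Otimes>\<^sub>M lborel) (case_prod ?G)"
    by (simp add: lborel_prod case_prod_unfold)
  show "AE b in lborel. integrable lborel (\<lambda>a. F (vector [a, b]))"
    using lborel_pair.AE_integrable_snd[OF G] .
  show "integrable lborel (\<lambda>b. (LINT a|lborel. F (vector [a, b])))"
    using lborel_pair.integrable_snd[OF G] .
  have "(LINT b|lborel. (LINT a|lborel. F (vector [a, b]))) = (LINT p|lborel. F (?T p))"
    using lborel_pair.integral_snd[OF G] by (simp add: lborel_prod case_prod_unfold)
  also have "\<dots> = (LINT w|distr lborel lborel ?T. F w)"
    by (rule integral_distr[symmetric]) (simp_all add: vector_2_measurable)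
  finally show "(LINT b|lborel. (LINT a|lborel. F (vector [a, b]))) = (LINT w|lborel. F w)"
    by (simp add: distr_lborel_vector_2)
qed

lemma vector_2_eta: "vector [z $ 1, z $ 2] = (z :: 'a::zero ^ 2)"
  by (simp add: vec_eq_iff forall_2)

lemma mv_holomorphic_on_const: "mv_holomorphic_on (\<lambda>z. c) \<Omega>"
  unfolding mv_holomorphic_on_def by (auto intro!: exI[where x = "\<lambda>_. 0"] derivative_eq_intros)

lemma mv_holomorphic_on_component: "mv_holomorphic_on (\<lambda>z. z $ i) \<Omega>"
  unfolding mv_holomorphic_on_def
  by (auto intro!: exI[where x = "\<lambda>v. v $ i"] bounded_linear_imp_has_derivative bounded_linear_vec_nth)

lemma mv_holomorphic_on_add:
  assumes "mv_holomorphic_on f \<Omega>" "mv_holomorphic_on g \<Omega>"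
  shows "mv_holomorphic_on (\<lambda>z. f z + g z) \<Omega>"
  unfolding mv_holomorphic_on_def
proof
  fix z assume "z \<in> \<Omega>"
  with assms obtain D E where "(f has_derivative D) (at z)" "\<forall>c v. D (c *s v) = c * D v"
    "(g has_derivative E) (at z)" "\<forall>c v. E (c *s v) = c * E v"
    unfolding mv_holomorphic_on_def by blast
  then show "\<exists>D. ((\<lambda>z. f z + g z) has_derivative D) (at z) \<and> (\<forall>c v. D (c *s v) = c * D v)"
    by (intro exI[where x = "\<lambda>v. D v + E v"]) (auto intro: has_derivative_add simp: algebra_simps)
qed

lemma mv_holomorphic_on_mult:
  assumes "mv_holomorphic_on f \<Omega>" "mv_holomorphic_on g \<Omega>"
  shows "mv_holomorphic_on (\<lambda>z. f z * g z) \<Omega>"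
  unfolding mv_holomorphic_on_def
proof
  fix z assume "z \<in> \<Omega>"
  with assms obtain D E where "(f has_derivative D) (at z)" "\<forall>c v. D (c *s v) = c * D v"
    "(g has_derivative E) (at z)" "\<forall>c v. E (c *s v) = c * E v"
    unfolding mv_holomorphic_on_def by blast
  then show "\<exists>D. ((\<lambda>z. f z * g z) has_derivative D) (at z) \<and> (\<forall>c v. D (c *s v) = c * D v)"
    by (intro exI[where x = "\<lambda>v. f z * E v + D v * g z"] conjI has_derivative_mult) (auto simp: algebra_simps)
qed

lemma mv_holomorphic_on_compose:
  assumes f: "mv_holomorphic_on f \<Omega>" and h: "h holomorphic_on S" "open S" and sub: "f ` \<Omega> \<subseteq> S"
  shows "mv_holomorphic_on (\<lambda>z. h (f z)) \<Omega>"
  unfolding mv_holomorphic_on_def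
proof
  fix z assume z: "z \<in> \<Omega>"
  then obtain D where D: "(f has_derivative D) (at z)" "\<forall>c v. D (c *s v) = c * D v"
    using f unfolding mv_holomorphic_on_def by blast
  have "(h has_field_derivative deriv h (f z)) (at (f z))"
    using h sub z by (intro holomorphic_derivI) auto
  then have "((\<lambda>z. h (f z)) has_derivative (\<lambda>v. deriv h (f z) * D v)) (at z)"
    using D(1) unfolding has_field_derivative_def by (rule has_derivative_compose[rotated])
  then show "\<exists>D. ((\<lambda>z. h (f z)) has_derivative D) (at z) \<and> (\<forall>c v. D (c *s v) = c * D v)"
    using D(2) by (intro exI[where x = "\<lambda>v. deriv h (f z) * D v"]) auto
qed

lemma mv_holomorphic_on_divide:
  assumes f: "mv_holomorphic_on f \<Omega>" and g: "mv_holomorphic_on g \<Omega>" and nz: "\<And>z. z \<in> \<Omega> \<Longrightarrow> g z \<noteq> 0"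
  shows "mv_holomorphic_on (\<lambda>z. f z / g z) \<Omega>"
  unfolding divide_inverse
  by (rule mv_holomorphic_on_mult[OF f mv_holomorphic_on_compose[OF g, where S = "-{0}"]])
     (use nz in \<open>auto intro!: holomorphic_intros\<close>)

lemma mv_holomorphic_on_diff:
  assumes "mv_holomorphic_on f \<Omega>" "mv_holomorphic_on g \<Omega>"
  shows "mv_holomorphic_on (\<lambda>z. f z - g z) \<Omega>"
  using mv_holomorphic_on_add[OF assms(1) mv_holomorphic_on_mult[OF mv_holomorphic_on_const[of "-1"] assms(2)]]
  by simp

lemma mv_holomorphic_on_power:
  assumes "mv_holomorphic_on f \<Omega>" shows "mv_holomorphic_on (\<lambda>z. f z ^ n) \<Omega>"
  by (rule mv_holomorphic_on_compose[OF assms, where S = UNIV]) (auto intro!: holomorphic_intros)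

lemmas mv_holomorphic_intros =
  mv_holomorphic_on_const mv_holomorphic_on_component mv_holomorphic_on_add mv_holomorphic_on_diff
  mv_holomorphic_on_mult mv_holomorphic_on_power mv_holomorphic_on_divide

lemma mv_holomorphic_on_transform:
  assumes f: "mv_holomorphic_on f \<Omega>" and \<Omega>: "open \<Omega>" and eq: "\<And>z. z \<in> \<Omega> \<Longrightarrow> f z = g z"
  shows "mv_holomorphic_on g \<Omega>"
  unfolding mv_holomorphic_on_def
proof
  fix z assume z: "z \<in> \<Omega>"
  then obtain D where D: "(f has_derivative D) (at z)" "\<forall>c v. D (c *s v) = c * D v"
    using f unfolding mv_holomorphic_on_def by blast
  from D(1) have "(g has_derivative D) (at z)"
    by (rule has_derivative_transform_within_open[OF _ \<Omega> z]) (rule eq)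
  with D(2) show "\<exists>D. (g has_derivative D) (at z) \<and> (\<forall>c v. D (c *s v) = c * D v)" by blast
qed

lemma mv_holomorphic_on_imp_continuous_on:
  "mv_holomorphic_on f \<Omega> \<Longrightarrow> continuous_on \<Omega> f"
  unfolding mv_holomorphic_on_def
  by (meson continuous_at_imp_continuous_on has_derivative_continuous)

text \<open>On a complex line, a complex linear derivative D is multiplication by the number
  \<open>D (axis j 1)\<close>. This gives access to the one-variable theory.\<close>

lemma mv_holomorphic_on_slice:
  assumes f: "mv_holomorphic_on f \<Omega>" and S: "open S" and sub: "\<And>t. t \<in> S \<Longrightarrow> v + axis j t \<in> \<Omega>"
  shows "(\<lambda>t. f (v + axis j t)) holomorphic_on S"
  unfolding holomorphic_on_open[OF S]
proof safe
  fix t assume "t \<in> S"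
  then obtain D where D: "(f has_derivative D) (at (v + axis j t))" "\<forall>c v. D (c *s v) = c * D v"
    using f sub unfolding mv_holomorphic_on_def by blast
  have "((\<lambda>t. v + axis j t) has_derivative (\<lambda>t. axis j t)) (at t)"
  proof -
    have "linear (\<lambda>t::complex. axis j t :: complex ^ 'a)"
      by (rule linearI) (auto simp: vec_eq_iff axis_def)
    then have "((\<lambda>t. axis j t :: complex ^ 'a) has_derivative (\<lambda>t. axis j t)) (at t)"
      by (intro bounded_linear_imp_has_derivative) (simp add: linear_conv_bounded_linear)
    then show ?thesis by (auto intro!: derivative_eq_intros)
  qed
  then have "((\<lambda>t. f (v + axis j t)) has_derivative (\<lambda>s. D (axis j s))) (at t)"
    using D(1) by (rule has_derivative_compose)
  also have "(\<lambda>s. D (axis j s)) = (*) (D (axis j 1))"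
  proof
    fix s
    have "axis j s = s *s (axis j 1 :: complex ^ 'a)" by (auto simp: vec_eq_iff axis_def)
    then show "D (axis j s) = (*) (D (axis j 1)) s" using D(2) by (metis mult.commute)
  qed
  finally have "((\<lambda>t. f (v + axis j t)) has_derivative (*) (D (axis j 1))) (at t)" .
  then show "\<exists>f'. ((\<lambda>t. f (v + axis j t)) has_field_derivative f') (at t)"
    unfolding has_field_derivative_def by blast
qed

lemma mv_holomorphic_on_set_borel_measurable:
  assumes "mv_holomorphic_on f \<Omega>" "open \<Omega>"
  shows "set_borel_measurable lborel \<Omega> f"
  unfolding set_borel_measurable_def
  using borel_measurable_continuous_on_indicator[OF _ mv_holomorphic_on_imp_continuous_on[OF assms(1)]] assms(2)
  by simp

text \<open>The pointwise bound |a b| \<le> |a|^2 + |b|^2 suffices here in place of the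
  Cauchy-Schwarz inequality.\<close>

lemma set_integrable_mult_of_squares:
  fixes f g :: "'a::euclidean_space \<Rightarrow> complex"
  assumes f: "set_borel_measurable lborel S f" "set_integrable lborel S (\<lambda>w. (norm (f w))\<^sup>2)"
    and g: "set_borel_measurable lborel S g" "set_integrable lborel S (\<lambda>w. (norm (g w))\<^sup>2)"
  shows "set_integrable lborel S (\<lambda>w. f w * g w)"
proof (rule set_integrable_bound[OF set_integral_add(1)[OF f(2) g(2)]])
  have "(\<lambda>w. (indicator S w *\<^sub>R f w) * (indicator S w *\<^sub>R g w)) \<in> borel_measurable lborel"
    using f(1) g(1) unfolding set_borel_measurable_def by (rule borel_measurable_times)
  moreover have "(\<lambda>w. (indicator S w *\<^sub>R f w) * (indicator S w *\<^sub>R g w)) = (\<lambda>w. indicator S w *\<^sub>R (f w * g w))"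
    by (auto simp: indicator_def)
  ultimately show "set_borel_measurable lborel S (\<lambda>w. f w * g w)"
    unfolding set_borel_measurable_def by simp
  have "norm (a * b) \<le> (norm a)\<^sup>2 + (norm b)\<^sup>2" for a b :: complex
    unfolding norm_mult
    using sum_squares_bound[of "norm a" "norm b"] mult_nonneg_nonneg[OF norm_ge_zero norm_ge_zero, of a b]
    by linarith
  then show "AE w in lborel. w \<in> S \<longrightarrow> norm (f w * g w) \<le> norm ((norm (f w))\<^sup>2 + (norm (g w))\<^sup>2)"
    by (simp add: abs_of_nonneg)
qed

text \<open>The set where h is nonzero is open and null, and a nonempty open set is never
  null.\<close>

lemma continuous_on_integral_norm_square_zero:
  fixes h :: "'a::euclidean_space \<Rightarrow> complex"
  assumes S: "open S" and h: "continuous_on S h"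
    and int: "set_integrable lborel S (\<lambda>w. (norm (h w))\<^sup>2)" and zero: "(LINT w:S|lborel. (norm (h w))\<^sup>2) = 0"
    and w: "w \<in> S"
  shows "h w = 0"
proof (rule ccontr)
  assume "h w \<noteq> 0"
  let ?U = "{w \<in> S. h w \<noteq> 0}"
  have U: "open ?U"
  proof -
    have "?U = S \<inter> h -` (- {0})" by auto
    then show ?thesis using continuous_open_preimage[OF h S, of "-{0}"] by (simp add: open_Compl)
  qed
  have "AE w in lborel. indicator S w *\<^sub>R (norm (h w))\<^sup>2 = 0"
    using int zero unfolding set_integrable_def set_lebesgue_integral_def
    by (subst (asm) integral_nonneg_eq_0_iff_AE) auto
  then have "AE w in lborel. w \<notin> ?U"
    by eventually_elim (auto simp: indicator_def)
  then have "?U \<in> null_sets lborel"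
    using U by (subst (asm) AE_iff_null_sets[symmetric]) auto
  then have "negligible ?U"
    by (simp add: negligible_iff_null_sets null_sets_completionI)
  then show False using open_not_negligible[OF U] w \<open>h w \<noteq> 0\<close> by auto
qed

text \<open>For fixed z let h be the difference of the conjugated kernels, as a function of w. Both
  kernels reproduce h at z, and subtracting the two formulas shows that the integral of |h|^2 is
  0.\<close>

lemma bergman_kernel_unique:
  fixes \<Omega> :: "(complex ^ 'n::finite) set"
  assumes \<Omega>: "open \<Omega>" and K: "is_bergman_kernel \<Omega> K" and L: "is_bergman_kernel \<Omega> L"
    and z: "z \<in> \<Omega>" and w: "w \<in> \<Omega>"
  shows "K z w = L z w"
proof -
  let ?k = "\<lambda>w. cnj (K z w)" and ?l = "\<lambda>w. cnj (L z w)"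
  let ?h = "\<lambda>w. ?k w - ?l w"
  have k: "?k \<in> bergman_space \<Omega>" and l: "?l \<in> bergman_space \<Omega>"
    using K L z by (auto simp: is_bergman_kernel_def)
  have hol: "mv_holomorphic_on ?h \<Omega>"
    using k l by (auto simp: bergman_space_def intro: mv_holomorphic_on_diff)
  have mk: "set_borel_measurable lborel \<Omega> ?k" "set_integrable lborel \<Omega> (\<lambda>w. (norm (?k w))\<^sup>2)"
    and ml: "set_borel_measurable lborel \<Omega> ?l" "set_integrable lborel \<Omega> (\<lambda>w. (norm (?l w))\<^sup>2)"
    using k l \<Omega> by (auto simp: bergman_space_def intro: mv_holomorphic_on_set_borel_measurable)
  have mh: "set_borel_measurable lborel \<Omega> ?h"
    using hol \<Omega> by (rule mv_holomorphic_on_set_borel_measurable)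
  have ih: "set_integrable lborel \<Omega> (\<lambda>w. (norm (?h w))\<^sup>2)"
  proof (rule set_integrable_bound)
    show "set_integrable lborel \<Omega> (\<lambda>w. 2 * (norm (?k w))\<^sup>2 + 2 * (norm (?l w))\<^sup>2)"
      using mk ml by (intro set_integral_add set_integrable_mult_right)
    have "(\<lambda>w. (norm (indicator \<Omega> w *\<^sub>R ?h w))\<^sup>2) \<in> borel_measurable lborel"
      using mh unfolding set_borel_measurable_def by measurable
    moreover have "(\<lambda>w. (norm (indicator \<Omega> w *\<^sub>R ?h w))\<^sup>2) = (\<lambda>w. indicator \<Omega> w *\<^sub>R (norm (?h w))\<^sup>2)"
      by (auto simp: indicator_def)
    ultimately show "set_borel_measurable lborel \<Omega> (\<lambda>w. (norm (?h w))\<^sup>2)"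
      unfolding set_borel_measurable_def by simp
    have bd: "(norm (a - b))\<^sup>2 \<le> 2 * (norm a)\<^sup>2 + 2 * (norm b)\<^sup>2" for a b :: complex
    proof -
      have "(norm (a - b))\<^sup>2 \<le> (norm a + norm b)\<^sup>2"
        by (intro power_mono norm_triangle_ineq4) auto
      also have "\<dots> \<le> 2 * (norm a)\<^sup>2 + 2 * (norm b)\<^sup>2"
        using sum_squares_bound[of "norm a" "norm b"] by (simp add: power2_sum)
      finally show ?thesis .
    qed
    show "AE x in lborel. x \<in> \<Omega> \<longrightarrow>
        norm ((norm (?h x))\<^sup>2) \<le> norm (2 * (norm (?k x))\<^sup>2 + 2 * (norm (?l x))\<^sup>2)"
    proof (intro AE_I2 impI)
      fix x
      show "norm ((norm (?h x))\<^sup>2) \<le> norm (2 * (norm (?k x))\<^sup>2 + 2 * (norm (?l x))\<^sup>2)"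
        using bd[of "?k x" "?l x"] by simp
    qed
  qed
  have hb: "?h \<in> bergman_space \<Omega>" using hol ih by (simp add: bergman_space_def)
  have cnj_meas: "set_borel_measurable lborel \<Omega> (\<lambda>w. cnj (f w))"
    if "set_borel_measurable lborel \<Omega> f" for f :: "complex ^ 'n \<Rightarrow> complex"
  proof -
    have "(\<lambda>w. cnj (indicator \<Omega> w *\<^sub>R f w)) \<in> borel_measurable lborel"
      using that unfolding set_borel_measurable_def
      by (rule measurable_compose[OF _ borel_measurable_continuous_onI]) (intro continuous_intros)
    then show ?thesis unfolding set_borel_measurable_def by simp
  qed
  have iK: "set_integrable lborel \<Omega> (\<lambda>w. ?h w * K z w)"
    using cnj_meas[OF mk(1)] mk(2) by (intro set_integrable_mult_of_squares mh ih) simp_all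
  have iL: "set_integrable lborel \<Omega> (\<lambda>w. ?h w * L z w)"
    using cnj_meas[OF ml(1)] ml(2) by (intro set_integrable_mult_of_squares mh ih) simp_all
  have "(LINT w:\<Omega>|lborel. ?h w * K z w) = ?h z" "(LINT w:\<Omega>|lborel. ?h w * L z w) = ?h z"
    using K L hb z by (auto simp: is_bergman_kernel_def)
  then have "0 = (LINT w:\<Omega>|lborel. ?h w * K z w - ?h w * L z w)"
    by (subst set_integral_diff(2)[OF iK iL]) simp
  also have "\<dots> = (LINT w:\<Omega>|lborel. of_real ((norm (?h w))\<^sup>2))"
    by (intro arg_cong[where f = "set_lebesgue_integral lborel \<Omega>"] ext, unfold complex_norm_square)
       (simp add: algebra_simps)
  also have "\<dots> = of_real (LINT w:\<Omega>|lborel. (norm (?h w))\<^sup>2)"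
    by (rule set_integral_complex_of_real)
  finally have "(LINT w:\<Omega>|lborel. (norm (?h w))\<^sup>2) = 0" by simp
  then have "?h w = 0"
    using w by (intro continuous_on_integral_norm_square_zero[OF \<Omega> mv_holomorphic_on_imp_continuous_on[OF hol] ih])
  then show ?thesis by simp
qed

section \<open>The Bergman kernel of the bidisc\<close>

lemma open_unit_polydisc: "open unit_polydisc"
  unfolding unit_polydisc_def by (intro open_Collect_conj open_Collect_less continuous_intros)

lemma convex_unit_polydisc: "convex unit_polydisc"
proof -
  have eq: "unit_polydisc = (\<lambda>z. z $ 1) -` ball 0 1 \<inter> (\<lambda>z. z $ 2) -` ball 0 1"
    by (auto simp: unit_polydisc_def)
  have lin: "linear (\<lambda>z::complex ^ 2. z $ i)" for i
    by (rule bounded_linear.linear[OF bounded_linear_vec_nth])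
  show ?thesis unfolding eq by (intro convex_Int convex_linear_vimage lin convex_ball)
qed

lemma is_domain_unit_polydisc: "is_domain unit_polydisc"
proof -
  have "0 \<in> unit_polydisc" by (simp add: unit_polydisc_def)
  then show ?thesis
    using open_unit_polydisc convex_connected[OF convex_unit_polydisc] by (auto simp: is_domain_def)
qed

lemma vector_2_in_unit_polydisc [simp]:
  "vector [a, b] \<in> unit_polydisc \<longleftrightarrow> a \<in> ball 0 1 \<and> b \<in> ball 0 1"
  by (simp add: unit_polydisc_def)

lemma bounded_mv_holomorphic_in_bergman_space:
  fixes \<Omega> :: "(complex ^ 'n::finite) set"
  assumes f: "mv_holomorphic_on f \<Omega>" and \<Omega>: "open \<Omega>" "bounded \<Omega>" and B: "\<And>z. z \<in> \<Omega> \<Longrightarrow> norm (f z) \<le> B"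
  shows "f \<in> bergman_space \<Omega>" and "set_integrable lborel \<Omega> f"
proof -
  have fin: "emeasure lborel \<Omega> < \<infinity>" using \<Omega>(2) by (rule emeasure_bounded_finite)
  have const: "set_integrable lborel \<Omega> (\<lambda>_. c)" for c :: real
    unfolding set_integrable_def using \<Omega>(1) fin by (intro integrable_scaleR_left) (simp add: integrable_indicator_iff)
  have m: "set_borel_measurable lborel \<Omega> f" using f \<Omega>(1) by (rule mv_holomorphic_on_set_borel_measurable)
  have "(\<lambda>w. (norm (indicator \<Omega> w *\<^sub>R f w))\<^sup>2) \<in> borel_measurable lborel"
    using m unfolding set_borel_measurable_def by measurable
  moreover have "(\<lambda>w. (norm (indicator \<Omega> w *\<^sub>R f w))\<^sup>2) = (\<lambda>w. indicator \<Omega> w *\<^sub>R (norm (f w))\<^sup>2)"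
    by (auto simp: indicator_def)
  ultimately have m2: "set_borel_measurable lborel \<Omega> (\<lambda>w. (norm (f w))\<^sup>2)"
    unfolding set_borel_measurable_def by simp
  show "set_integrable lborel \<Omega> f"
    using B by (intro set_integrable_bound[OF const[of B] m] AE_I2 impI) fastforce
  have "set_integrable lborel \<Omega> (\<lambda>w. (norm (f w))\<^sup>2)"
    using B by (intro set_integrable_bound[OF const[of "B\<^sup>2"] m2] AE_I2 impI) (simp add: power_mono)
  then show "f \<in> bergman_space \<Omega>" using f by (simp add: bergman_space_def)
qed

lemma bounded_unit_polydisc: "bounded unit_polydisc"
proof -
  have "norm z \<le> 2" if "z \<in> unit_polydisc" for z
    using that L2_set_le_sum[of UNIV "\<lambda>i. norm (z $ i)"]
    by (simp add: norm_vec_def sum_2 unit_polydisc_def)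
  then show ?thesis by (auto simp: bounded_iff)
qed

definition polydisc_kernel :: "complex ^ 2 \<Rightarrow> complex ^ 2 \<Rightarrow> complex" where
  "polydisc_kernel z w = 1 / (pi\<^sup>2 * ((1 - z $ 1 * cnj (w $ 1))\<^sup>2 * (1 - z $ 2 * cnj (w $ 2))\<^sup>2))"

text \<open>For fixed z the kernel stays bounded up to the boundary in w, since |1 - a * cnj b|
  \<ge> 1 - |a|; on a bounded domain this gives square integrability.\<close>

lemma cnj_polydisc_kernel_in_bergman_space:
  assumes z: "z \<in> unit_polydisc"
  shows "(\<lambda>w. cnj (polydisc_kernel z w)) \<in> bergman_space unit_polydisc"
proof (rule bounded_mv_holomorphic_in_bergman_space(1)[OF _ open_unit_polydisc bounded_unit_polydisc])
  have z12: "norm (z $ 1) < 1" "norm (z $ 2) < 1" using z by (auto simp: unit_polydisc_def)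
  have eq: "(\<lambda>w. cnj (polydisc_kernel z w))
      = (\<lambda>w. 1 / (pi\<^sup>2 * ((1 - cnj (z $ 1) * w $ 1)\<^sup>2 * (1 - cnj (z $ 2) * w $ 2)\<^sup>2)))"
    by (simp add: polydisc_kernel_def)
  have nz: "cnj (z $ i) * w $ i \<noteq> 1" if "w \<in> unit_polydisc" "i = 1 \<or> i = 2" for w i
    using norm_one_minus_mult_cnj_pos(2)[of "w $ i" "z $ i"] that z12 by (auto simp: unit_polydisc_def)
  show "mv_holomorphic_on (\<lambda>w. cnj (polydisc_kernel z w)) unit_polydisc"
    unfolding eq by (intro mv_holomorphic_intros) (simp add: nz)
  fix w assume w: "w \<in> unit_polydisc"
  have low: "1 - norm a \<le> norm (1 - a * cnj b)" if "norm b < 1" for a b :: complex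
  proof -
    have "norm a * norm b \<le> norm a * 1" using that by (intro mult_left_mono) auto
    then show ?thesis using norm_triangle_ineq2[of 1 "a * cnj b"] by (simp add: norm_mult)
  qed
  have "pi\<^sup>2 * ((1 - norm (z $ 1))\<^sup>2 * (1 - norm (z $ 2))\<^sup>2)
      \<le> pi\<^sup>2 * ((norm (1 - z $ 1 * cnj (w $ 1)))\<^sup>2 * (norm (1 - z $ 2 * cnj (w $ 2)))\<^sup>2)"
    using z12 w low by (intro mult_mono power_mono) (auto simp: unit_polydisc_def)
  moreover have "0 < pi\<^sup>2 * ((1 - norm (z $ 1))\<^sup>2 * (1 - norm (z $ 2))\<^sup>2)" using z12 by simp
  moreover have "norm (cnj (polydisc_kernel z w))
      = 1 / (pi\<^sup>2 * ((norm (1 - z $ 1 * cnj (w $ 1)))\<^sup>2 * (norm (1 - z $ 2 * cnj (w $ 2)))\<^sup>2))"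
    unfolding polydisc_kernel_def complex_mod_cnj by (simp add: norm_divide norm_mult norm_power)
  ultimately show "norm (cnj (polydisc_kernel z w)) \<le> 1 / (pi\<^sup>2 * ((1 - norm (z $ 1))\<^sup>2 * (1 - norm (z $ 2))\<^sup>2))"
    by (metis frac_le order_refl zero_le_one)
qed

lemma vector_2_eq_axis:
  "vector [a, b] = (vector [0, b] + axis 1 a :: complex ^ 2)" "vector [a, b] = (vector [a, 0] + axis 2 b :: complex ^ 2)"
  by (simp_all add: vec_eq_iff forall_2 axis_def)

text \<open>The disc formula is applied in the first coordinate and then in the second. Fubini gives
  integrable slices only for almost every b, so the inner integral I is replaced by the explicit
  function J, which is measurable by continuity and inherits integrability from I.\<close>

lemma polydisc_kernel_reproducing:
  assumes f: "f \<in> bergman_space unit_polydisc" and z: "z \<in> unit_polydisc"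
  shows "(LINT w:unit_polydisc|lborel. f w * polydisc_kernel z w) = f z"
proof -
  have z12: "norm (z $ 1) < 1" "norm (z $ 2) < 1" using z by (auto simp: unit_polydisc_def)
  have hol: "mv_holomorphic_on f unit_polydisc" and sq: "set_integrable lborel unit_polydisc (\<lambda>w. (norm (f w))\<^sup>2)"
    using f by (auto simp: bergman_space_def)
  have hk: "set_borel_measurable lborel unit_polydisc (\<lambda>w. cnj (polydisc_kernel z w))"
      "set_integrable lborel unit_polydisc (\<lambda>w. (norm (polydisc_kernel z w))\<^sup>2)"
    using cnj_polydisc_kernel_in_bergman_space[OF z] open_unit_polydisc
    by (auto simp: bergman_space_def intro: mv_holomorphic_on_set_borel_measurable)
  define F where "F w = indicator unit_polydisc w *\<^sub>R (f w * polydisc_kernel z w)" for w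
  have mk: "set_borel_measurable lborel unit_polydisc (polydisc_kernel z)"
  proof -
    have "(\<lambda>w. cnj (indicator unit_polydisc w *\<^sub>R cnj (polydisc_kernel z w))) \<in> borel_measurable lborel"
      using hk(1) unfolding set_borel_measurable_def
      by (rule measurable_compose[OF _ borel_measurable_continuous_onI]) (intro continuous_intros)
    then show ?thesis unfolding set_borel_measurable_def by simp
  qed
  have "set_integrable lborel unit_polydisc (\<lambda>w. f w * polydisc_kernel z w)"
    by (rule set_integrable_mult_of_squares[OF mv_holomorphic_on_set_borel_measurable[OF hol open_unit_polydisc] sq mk hk(2)])
  then have F: "integrable lborel F" by (simp add: F_def[abs_def] set_integrable_def)
  define I where "I b = (LINT a|lborel. F (vector [a, b]))" for b
  define J where "J b = indicator (ball 0 1) b *\<^sub>R ((f (vector [z $ 1, b]) / pi) / (1 - z $ 2 * cnj b)\<^sup>2)" for b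
  have g1: "(\<lambda>a. f (vector [a, b])) holomorphic_on ball 0 1" if "b \<in> ball 0 1" for b
  proof -
    have "(\<lambda>a. f (vector [0, b] + axis 1 a)) holomorphic_on ball 0 1"
      using that by (intro mv_holomorphic_on_slice[OF hol]) (simp_all add: vector_2_eq_axis(1)[symmetric])
    then show ?thesis by (simp only: vector_2_eq_axis(1)[symmetric])
  qed
  have g2: "(\<lambda>b. f (vector [z $ 1, b]) / pi) holomorphic_on ball 0 1"
  proof -
    have "(\<lambda>b. f (vector [z $ 1, 0] + axis 2 b)) holomorphic_on ball 0 1"
      using z12 by (intro mv_holomorphic_on_slice[OF hol]) (simp_all add: vector_2_eq_axis(2)[symmetric])
    then have "(\<lambda>b. f (vector [z $ 1, b])) holomorphic_on ball 0 1"
      by (simp only: vector_2_eq_axis(2)[symmetric])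
    then show ?thesis by (intro holomorphic_intros) auto
  qed
  have IJ: "AE b in lborel. I b = J b"
    using Fubini_vector_2(1)[OF F]
  proof eventually_elim
    fix b assume int: "integrable lborel (\<lambda>a. F (vector [a, b]))"
    show "I b = J b"
    proof (cases "b \<in> ball 0 1")
      case True
      define c where "c = 1 / (pi\<^sup>2 * (1 - z $ 2 * cnj b)\<^sup>2)"
      have Fa: "F (vector [a, b]) = indicator (ball 0 1) a *\<^sub>R (f (vector [a, b]) * c / (1 - z $ 1 * cnj a)\<^sup>2)" for a
        using True by (simp add: F_def polydisc_kernel_def c_def indicator_def mult_ac)
      have "I b = (LINT a:ball 0 1|lborel. f (vector [a, b]) * c / (1 - z $ 1 * cnj a)\<^sup>2)"
        unfolding I_def Fa set_lebesgue_integral_def ..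
      also have "\<dots> = pi * (f (vector [z $ 1, b]) * c)"
        using int unfolding Fa
        by (intro disc_kernel_reproducing holomorphic_intros g1 True z12) (simp add: set_integrable_def)
      also have "\<dots> = J b" using True by (simp add: J_def c_def power2_eq_square)
      finally show ?thesis .
    next
      case False
      then have "F (vector [a, b]) = 0" for a by (simp add: F_def)
      then show ?thesis using False by (simp add: I_def J_def)
    qed
  qed
  have "continuous_on (ball 0 1) (\<lambda>b. (f (vector [z $ 1, b]) / pi) / (1 - z $ 2 * cnj b)\<^sup>2)"
    using norm_one_minus_mult_cnj_pos[OF z12(2)]
    by (intro continuous_on_divide holomorphic_on_imp_continuous_on[OF g2] continuous_intros) auto
  then have Jm: "J \<in> borel_measurable lborel"
    unfolding J_def using borel_measurable_continuous_on_indicator[of "ball 0 1"] by simp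
  have iI: "integrable lborel I" unfolding I_def using Fubini_vector_2(2)[OF F] .
  then have iJ: "integrable lborel J"
    using IJ Jm by (subst integrable_cong_AE[where g = I]) (auto simp: borel_measurable_integrable)
  have "(LINT w:unit_polydisc|lborel. f w * polydisc_kernel z w) = (LINT w|lborel. F w)"
    by (simp add: F_def set_lebesgue_integral_def)
  also have "\<dots> = (LINT b|lborel. I b)" unfolding I_def by (rule Fubini_vector_2(3)[OF F, symmetric])
  also have "\<dots> = (LINT b|lborel. J b)"
    using iI Jm IJ by (intro integral_cong_AE) (auto simp: borel_measurable_integrable)
  also have "\<dots> = (LINT b:ball 0 1|lborel. (f (vector [z $ 1, b]) / pi) / (1 - z $ 2 * cnj b)\<^sup>2)"
    by (simp add: J_def set_lebesgue_integral_def)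
  also have "\<dots> = pi * (f (vector [z $ 1, z $ 2]) / pi)"
    using iJ by (intro disc_kernel_reproducing g2 z12) (simp add: J_def[abs_def] set_integrable_def)
  finally show ?thesis by (simp add: vector_2_eta)
qed

text \<open>The kernel is defined by a choice: the explicit formula shows that a kernel exists, and
  uniqueness then fixes the values of the chosen one on the bidisc.\<close>

lemma bergman_kernel_unit_polydisc:
  assumes "z \<in> unit_polydisc" "w \<in> unit_polydisc"
  shows "bergman_kernel unit_polydisc z w = polydisc_kernel z w"
proof -
  have "mv_holomorphic_on (\<lambda>z. polydisc_kernel z w) unit_polydisc" if "w \<in> unit_polydisc" for w
    unfolding polydisc_kernel_def
    using that norm_one_minus_mult_cnj_pos by (intro mv_holomorphic_intros) (auto simp: unit_polydisc_def)
  then have K: "is_bergman_kernel unit_polydisc polydisc_kernel"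
    by (simp add: is_bergman_kernel_def cnj_polydisc_kernel_in_bergman_space polydisc_kernel_reproducing)
  then have "is_bergman_kernel unit_polydisc (bergman_kernel unit_polydisc)"
    unfolding bergman_kernel_def by (rule someI[where P = "is_bergman_kernel unit_polydisc"])
  then show ?thesis using K assms by (rule bergman_kernel_unique[OF open_unit_polydisc])
qed

text \<open>In the index type \<open>2\<close> the numeral \<open>2\<close> equals \<open>0\<close>, so the second coordinate comes first.\<close>
lemma multi_partial_2:
  fixes d :: "2 \<Rightarrow> (complex ^ 2 \<Rightarrow> complex) \<Rightarrow> complex ^ 2 \<Rightarrow> complex"
  shows "multi_partial d \<alpha> g = (d 1 ^^ \<alpha> 1) ((d 2 ^^ \<alpha> 2) g)"
proof -
  have "(2::2) = 0" by simp
  then have "(2::2) < 1"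
    by (simp only: less_bit0_def bit0.Rep_0 bit0.Rep_1)
  then have "sorted_list_of_set (UNIV :: 2 set) = [2, 1]"
    unfolding UNIV_2 by (simp add: insort_is_Cons)
  then show ?thesis by (simp add: multi_partial_def)
qed

text \<open>Along direction c of the j-th axis the derivative at 0 is 2 * z_j * cnj c / pi^2. For c
  = 1 and c = i the Wirtinger combination adds two equal terms, as i * cnj i = 1.\<close>

lemma partial_zbar_bergman_kernel_unit_polydisc:
  assumes z: "z \<in> unit_polydisc"
  shows "partial_zbar j (bergman_kernel unit_polydisc z) 0 = 2 * z $ j / pi\<^sup>2"
proof -
  let ?K = "bergman_kernel unit_polydisc z"
  have vd: "vector_derivative (\<lambda>t::real. ?K (axis j (c * of_real t))) (at 0) = 2 * z $ j * cnj c / pi\<^sup>2"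
    if c: "norm c = 1" for c
  proof (rule vector_derivative_at, rule has_vector_derivative_transform_within_open)
    have "((\<lambda>s. 1 / (pi\<^sup>2 * (1 - z $ j * cnj c * s)\<^sup>2)) has_field_derivative 2 * z $ j * cnj c / pi\<^sup>2) (at (of_real 0))"
      by (auto intro!: derivative_eq_intros simp: power2_eq_square)
    then show "((\<lambda>t. 1 / (pi\<^sup>2 * (1 - z $ j * cnj c * of_real t)\<^sup>2)) has_vector_derivative 2 * z $ j * cnj c / pi\<^sup>2) (at 0)"
      by (rule has_vector_derivative_real_field)
    \<comment> \<open>For these t the point \<open>axis j (c * of_real t)\<close> lies in the
      bidisc, which is where the chosen kernel is known explicitly.\<close>
    show "open {-1<..<1::real}" "0 \<in> {-1<..<1::real}" by auto
    fix t :: real assume "t \<in> {-1<..<1}"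
    then have "axis j (c * of_real t) \<in> unit_polydisc"
      using c by (auto simp: unit_polydisc_def axis_def norm_mult)
    then show "1 / (pi\<^sup>2 * (1 - z $ j * cnj c * of_real t)\<^sup>2) = ?K (axis j (c * of_real t))"
      using z exhaust_2[of j] by (auto simp: bergman_kernel_unit_polydisc polydisc_kernel_def axis_def mult.assoc)
  qed
  show ?thesis
    using vd[of 1] vd[of \<i>] by (simp add: partial_zbar_def field_simps)
qed

lemma affine_in_bergman_span_unit_polydisc:
  "(\<lambda>z. a + b * z $ 1 + c * z $ 2) \<in> bergman_span unit_polydisc"
proof -
  define e :: "2 \<Rightarrow> 2 \<Rightarrow> nat" where "e j i = (if i = j then 1 else 0)" for i j
  let ?S = "{0} \<times> {\<lambda>_. 0, e 1, e 2}"
  \<comment> \<open>At w = 0 the kernel is 1 / pi^2 and its first derivatives are 2 * z_j / pi^2,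
    which explains the weights pi^2 and pi^2 / 2.\<close>
  define k where "k w \<alpha> = (if \<alpha> = (\<lambda>_. 0) then a * pi\<^sup>2 else if \<alpha> = e 1 then b * pi\<^sup>2 / 2 else c * pi\<^sup>2 / 2)"
    for w :: "complex ^ 2" and \<alpha> :: "2 \<Rightarrow> nat"
  have d: "e 1 \<noteq> (\<lambda>_. 0)" "e 2 \<noteq> (\<lambda>_. 0)" "e 2 \<noteq> e 1"
    by (auto simp: e_def fun_eq_iff)
  have z0: "0 \<in> unit_polydisc" by (simp add: unit_polydisc_def)
  have "a + b * z $ 1 + c * z $ 2 =
      (\<Sum>(w, \<alpha>)\<in>?S. k w \<alpha> * multi_partial partial_zbar \<alpha> (bergman_kernel unit_polydisc z) w)"
    if z: "z \<in> unit_polydisc" for z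
  proof -
    have "multi_partial partial_zbar (\<lambda>_. 0) (bergman_kernel unit_polydisc z) 0 = 1 / pi\<^sup>2"
      using z z0 by (simp add: multi_partial_2 bergman_kernel_unit_polydisc polydisc_kernel_def)
    moreover have "multi_partial partial_zbar (e j) (bergman_kernel unit_polydisc z) 0 = 2 * z $ j / pi\<^sup>2" for j
      using exhaust_2[of j] z
      by (auto simp: multi_partial_2 e_def partial_zbar_bergman_kernel_unit_polydisc)
    ultimately show ?thesis
      using d d[symmetric] by (simp add: sum.cartesian_product[symmetric] k_def)
  qed
  moreover have "finite ?S" "?S \<subseteq> unit_polydisc \<times> UNIV" using z0 by auto
  ultimately show ?thesis
    unfolding bergman_span_def by blast
qed

section \<open>The image domain\<close>

text \<open>The image is described through the inverse map: \<open>w $ 2\<close> and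
  \<open>3 - w $ 2 - 1 / w $ 1\<close> are the coordinates z1 and z2 of the preimage.\<close>

definition coord_image :: "(complex ^ 2) set" where
  "coord_image = {w. w $ 1 \<noteq> 0 \<and> norm (w $ 2) < 1 \<and> norm (3 - w $ 2 - 1 / w $ 1) < 1}"

lemma norm_three_minus:
  assumes "norm (a::complex) < 1" "norm b < 1" shows "1 < norm (3 - a - b)" "norm (3 - a - b) < 5"
proof -
  have "norm (3::complex) \<le> norm (3 - a - b) + norm (a + b)"
    using norm_triangle_ineq[of "3 - a - b" "a + b"] by simp
  then show "1 < norm (3 - a - b)" using norm_triangle_ineq[of a b] assms by simp
  have "norm (3 - a - b) \<le> 3 + norm (a + b)"
    using norm_triangle_ineq4[of 3 "a + b"] by (simp add: algebra_simps)
  then show "norm (3 - a - b) < 5" using norm_triangle_ineq[of a b] assms by simp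
qed

lemma coord_map_props:
  fixes f :: "complex ^ 2 \<Rightarrow> complex ^ 2"
  assumes f: "\<And>z. z \<in> unit_polydisc \<Longrightarrow> f z = vector [1 / (3 - z $ 1 - z $ 2), z $ 1]"
  shows coord_map_image: "f ` unit_polydisc = coord_image"
    and coord_map_inj: "inj_on f unit_polydisc"
    and coord_map_inverse: "w \<in> coord_image \<Longrightarrow> the_inv_into unit_polydisc f w = vector [w $ 2, 3 - w $ 2 - 1 / w $ 1]"
proof -
  let ?\<psi> = "\<lambda>w::complex ^ 2. vector [w $ 2, 3 - w $ 2 - 1 / w $ 1] :: complex ^ 2"
  have nz: "3 - z $ 1 - z $ 2 \<noteq> 0" if "z \<in> unit_polydisc" for z :: "complex ^ 2"
    using norm_three_minus(1)[of "z $ 1" "z $ 2"] that by (auto simp: unit_polydisc_def)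
  have inv: "?\<psi> (f z) = z" if "z \<in> unit_polydisc" for z
    using that by (simp add: f vec_eq_iff forall_2)
  have mem: "f z \<in> coord_image" if "z \<in> unit_polydisc" for z
    using that nz[OF that] by (simp add: f coord_image_def unit_polydisc_def)
  have \<psi>: "?\<psi> w \<in> unit_polydisc" "f (?\<psi> w) = w" if "w \<in> coord_image" for w
  proof -
    show "?\<psi> w \<in> unit_polydisc" using that by (simp add: coord_image_def)
    from f[OF this] show "f (?\<psi> w) = w" by (simp add: vec_eq_iff forall_2)
  qed
  show "f ` unit_polydisc = coord_image"
  proof
    show "f ` unit_polydisc \<subseteq> coord_image" using mem by auto
    show "coord_image \<subseteq> f ` unit_polydisc"
    proof
      fix w assume "w \<in> coord_image"
      from \<psi>[OF this] show "w \<in> f ` unit_polydisc" by (metis imageI)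
    qed
  qed
  show inj: "inj_on f unit_polydisc" using inv by (rule inj_on_inverseI)
  show "the_inv_into unit_polydisc f w = ?\<psi> w" if "w \<in> coord_image"
    using \<psi>[OF that] by (intro the_inv_into_f_eq[OF inj])
qed

lemma open_coord_image: "open coord_image"
proof -
  let ?U = "{w::complex ^ 2. w $ 1 \<noteq> 0 \<and> norm (w $ 2) < 1}"
  have "open ?U" by (intro open_Collect_conj open_Collect_less open_Collect_neq continuous_intros)
  moreover have "continuous_on ?U (\<lambda>w. 3 - w $ 2 - 1 / w $ 1)" by (intro continuous_intros) auto
  ultimately have "open (?U \<inter> (\<lambda>w. 3 - w $ 2 - 1 / w $ 1) -` ball 0 1)"
    by (intro continuous_open_preimage) auto
  moreover have "coord_image = ?U \<inter> (\<lambda>w. 3 - w $ 2 - 1 / w $ 1) -` ball 0 1"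
    by (auto simp: coord_image_def)
  ultimately show ?thesis by simp
qed

text \<open>The number 1 / w1 = 3 - z1 - z2 has modulus between 1 and 5. The lower bound on |w1|
  later keeps the denominator of the test function away from 0.\<close>

lemma coord_image_bounds:
  assumes w: "w \<in> coord_image"
  shows "norm (w $ 1) < 1" "1 / 5 < norm (w $ 1)" "norm (w $ 2) < 1"
proof -
  have nz: "w $ 1 \<noteq> 0" and w2: "norm (w $ 2) < 1" and z2: "norm (3 - w $ 2 - 1 / w $ 1) < 1"
    using w by (auto simp: coord_image_def)
  have "3 - w $ 2 - (3 - w $ 2 - 1 / w $ 1) = 1 / w $ 1" by simp
  then have "1 < norm (1 / w $ 1)" "norm (1 / w $ 1) < 5"
    using norm_three_minus[OF w2 z2] by simp_all
  then show "norm (w $ 1) < 1" "1 / 5 < norm (w $ 1)" "norm (w $ 2) < 1"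
    using nz w2 by (simp_all add: norm_divide divide_simps)
qed

lemma bounded_coord_image: "bounded coord_image"
proof -
  have "norm w \<le> 2" if "w \<in> coord_image" for w
    using coord_image_bounds[OF that] L2_set_le_sum[of UNIV "\<lambda>i. norm (w $ i)"]
    by (simp add: norm_vec_def sum_2)
  then show ?thesis by (auto simp: bounded_iff)
qed

text \<open>Inversion maps the disc of radius \<open>1\<close> about \<open>A\<close> to the disc described on the left.\<close>
lemma mem_inverted_disc_iff:
  fixes A a :: complex
  assumes A: "1 < norm A"
  shows "a \<in> ball (cnj A / of_real ((norm A)\<^sup>2 - 1)) (1 / ((norm A)\<^sup>2 - 1)) \<longleftrightarrow> a \<noteq> 0 \<and> norm (A - 1 / a) < 1"
proof -
  define d where "d = (norm A)\<^sup>2 - 1"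
  have d: "0 < d" using A by (simp add: d_def power_strict_mono[of 1, simplified] one_less_power)
  have sq: "x < y \<longleftrightarrow> x\<^sup>2 < y\<^sup>2" if "0 \<le> x" "0 \<le> y" for x y :: real
    using that by (metis power_less_imp_less_base power_strict_mono zero_less_numeral)
  have "norm (a - cnj A / of_real d) * d = norm (d * a - cnj A)"
  proof -
    have "norm (a - cnj A / of_real d) * d = norm (of_real d * (a - cnj A / of_real d))"
      using d by (simp add: norm_mult)
    also have "of_real d * (a - cnj A / of_real d) = d * a - cnj A"
      using d by (simp add: field_simps)
    finally show ?thesis .
  qed
  then have "a \<in> ball (cnj A / of_real d) (1 / d) \<longleftrightarrow> norm (d * a - cnj A) < 1"
    using d by (simp add: dist_norm norm_minus_commute pos_less_divide_eq)
  also have "\<dots> \<longleftrightarrow> (norm (d * a - cnj A))\<^sup>2 < 1"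
    using sq[of "norm (d * a - cnj A)" 1] by simp
  \<comment> \<open>Because |A|^2 = d + 1, both sides equal d * (d * |a|^2 - 2 * Re (A * a) +
    1).\<close>
  also have "(norm (d * a - cnj A))\<^sup>2 - 1 = d * ((norm (A * a - 1))\<^sup>2 - (norm a)\<^sup>2)"
    unfolding d_def cmod_power2 by (simp add: power2_eq_square algebra_simps)
  then have "(norm (d * a - cnj A))\<^sup>2 < 1 \<longleftrightarrow> d * ((norm (A * a - 1))\<^sup>2 - (norm a)\<^sup>2) < 0"
    by linarith
  also have "\<dots> \<longleftrightarrow> norm (A * a - 1) < norm a"
    using d sq[of "norm (A * a - 1)" "norm a"] by (simp add: mult_less_0_iff)
  also have "\<dots> \<longleftrightarrow> a \<noteq> 0 \<and> norm (A - 1 / a) < 1"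
  proof (cases "a = 0")
    case False
    then have "A * a - 1 = (A - 1 / a) * a" by (simp add: field_simps)
    then have "norm (A * a - 1) = norm (A - 1 / a) * norm a" by (simp add: norm_mult)
    then show ?thesis using False by simp
  qed simp
  finally show ?thesis unfolding d_def .
qed

lemma coord_image_slice:
  assumes b: "norm b < 1"
  shows "vector [a, b] \<in> coord_image \<longleftrightarrow>
     a \<in> ball (cnj (3 - b) / of_real ((norm (3 - b))\<^sup>2 - 1)) (1 / ((norm (3 - b))\<^sup>2 - 1))"
proof -
  have "1 < norm (3 - b)" using norm_three_minus(1)[OF b, of 0] by simp
  from mem_inverted_disc_iff[OF this, of a] show ?thesis using b by (simp add: coord_image_def)
qed

section \<open>Iterated partial derivatives of functions vanishing to high order\<close>

lemma deriv_shift_0: "deriv (\<lambda>t. \<phi> (t + s)) 0 = deriv \<phi> s"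
  unfolding deriv_def using DERIV_shift[of \<phi> _ 0 s] by simp

text \<open>Each application of \<open>partial_z\<close> differentiates at 0 after a shift of the
  base point. The induction therefore covers all points \<open>v + axis j s\<close> of the line at
  once, since the next derivative needs the values nearby.\<close>

lemma funpow_partial_z:
  "(partial_z j ^^ k) g v = (deriv ^^ k) (\<lambda>t. g (v + axis j t)) 0"
proof -
  have "(partial_z j ^^ k) g (v + axis j s) = (deriv ^^ k) (\<lambda>t. g (v + axis j t)) s" for s
  proof (induction k arbitrary: s)
    case (Suc k)
    let ?\<phi> = "(deriv ^^ k) (\<lambda>t. g (v + axis j t))"
    have ax: "v + axis j s + axis j t = v + axis j (t + s)" for t :: complex
      by (auto simp: vec_eq_iff axis_def)
    have "(partial_z j ^^ Suc k) g (v + axis j s) = deriv (\<lambda>t. ?\<phi> (t + s)) 0"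
      by (simp add: partial_z_def ax Suc)
    also have "\<dots> = deriv ?\<phi> s"
      by (rule deriv_shift_0)
    finally show ?case by simp
  qed simp
  from this[of 0] show ?thesis by (simp add: axis_def zero_vec_def[symmetric])
qed

lemma higher_deriv_monomial_0:
  assumes "i < n" shows "(deriv ^^ i) (\<lambda>t::complex. t ^ n) 0 = 0"
proof -
  have "i \<le> n \<Longrightarrow> \<exists>c. (deriv ^^ i) (\<lambda>t::complex. t ^ n) = (\<lambda>t. c * t ^ (n - i))"
  proof (induction i)
    case 0
    show ?case by (intro exI[where x = 1]) simp
  next
    case (Suc i)
    then obtain c where c: "(deriv ^^ i) (\<lambda>t::complex. t ^ n) = (\<lambda>t. c * t ^ (n - i))" by auto
    have "deriv (\<lambda>t. c * t ^ (n - i)) t = c * of_nat (n - i) * t ^ (n - Suc i)" for t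
      by (rule DERIV_imp_deriv) (auto intro!: derivative_eq_intros)
    then show ?case using c by auto
  qed
  then show ?thesis using assms by (auto simp: power_0_left)
qed

text \<open>In the Leibniz expansion every term contains a derivative of t^n at 0 of order at most k
  < n, and these are all 0.\<close>

lemma higher_deriv_high_order_zero:
  assumes G: "G holomorphic_on S" "open S" "0 \<in> S" and k: "k < n"
    and \<phi>: "\<And>t. t \<in> S \<Longrightarrow> \<phi> t = t ^ n * G t"
  shows "(deriv ^^ k) \<phi> 0 = 0"
proof -
  have "\<phi> holomorphic_on S"
    using \<phi> G(1) by (subst holomorphic_cong[OF refl, of _ _ "\<lambda>t. t ^ n * G t"]) (auto intro!: holomorphic_intros)
  then have "(deriv ^^ k) \<phi> 0 = (deriv ^^ k) (\<lambda>t. t ^ n * G t) 0"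
    using G \<phi> by (intro higher_deriv_transform_within_open[where S = S]) (auto intro!: holomorphic_intros)
  also have "\<dots> = (\<Sum>i = 0..k. of_nat (k choose i) * (deriv ^^ i) (\<lambda>t. t ^ n) 0 * (deriv ^^ (k - i)) G 0)"
    using G by (intro higher_deriv_mult[where S = S]) (auto intro!: holomorphic_intros)
  also have "\<dots> = 0"
  proof (rule sum.neutral, safe)
    fix i assume "i \<in> {0..k}"
    then show "of_nat (k choose i) * (deriv ^^ i) (\<lambda>t. t ^ n) 0 * (deriv ^^ (k - i)) G 0 = 0"
      using higher_deriv_monomial_0[of i n] k by simp
  qed
  finally show ?thesis .
qed

text \<open>All derivatives in the second variable are taken first and vanish on the slice \<open>w $ 2 = p $ 2\<close>.\<close>
lemma multi_partial_vanishes: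
  fixes \<Omega> :: "(complex ^ 2) set"
  assumes \<Omega>: "open \<Omega>" and p: "p \<in> \<Omega>" and G: "mv_holomorphic_on G \<Omega>" and n: "\<alpha> 2 < n"
    and h: "\<And>w. w \<in> \<Omega> \<Longrightarrow> h w = (w $ 2 - p $ 2) ^ n * G w"
  shows "multi_partial partial_z \<alpha> h p = 0"
proof -
  have cont: "continuous_on UNIV (\<lambda>t. v + axis j t)" for v :: "complex ^ 2" and j
  proof -
    have "linear (\<lambda>t::complex. axis j t :: complex ^ 2)"
      by (rule linearI) (auto simp: vec_eq_iff axis_def)
    then show ?thesis by (intro continuous_intros linear_continuous_on) (simp add: linear_conv_bounded_linear)
  qed
  have op: "open ((\<lambda>t. v + axis j t) -` \<Omega>)" for v j
    using cont \<Omega> by (rule open_vimage[rotated])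
  have ax0: "axis j 0 = (0 :: complex ^ 2)" for j by (simp add: vec_eq_iff axis_def)
  have zero: "(partial_z 2 ^^ \<alpha> 2) h v = 0" if v: "v \<in> \<Omega>" "v $ 2 = p $ 2" for v
    unfolding funpow_partial_z
  proof (rule higher_deriv_high_order_zero[OF _ op _ n])
    show "(\<lambda>t. G (v + axis 2 t)) holomorphic_on (\<lambda>t. v + axis 2 t) -` \<Omega>"
      by (rule mv_holomorphic_on_slice[OF G op]) simp
    show "0 \<in> (\<lambda>t. v + axis 2 t) -` \<Omega>" using v by (simp add: ax0)
    show "h (v + axis 2 t) = t ^ n * G (v + axis 2 t)" if "t \<in> (\<lambda>t. v + axis 2 t) -` \<Omega>" for t
      using that v by (simp add: h)
  qed
  \<comment> \<open>Moving along the first axis keeps the second coordinate at \<open>p $ 2\<close>,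
    so the inner derivative is 0 on a whole neighbourhood, and its derivatives in the first variable
    vanish whatever \<open>\<alpha> 1\<close> is.\<close>
  let ?\<phi> = "\<lambda>t. (partial_z 2 ^^ \<alpha> 2) h (p + axis 1 t)"
  have z: "?\<phi> t = 0" if "t \<in> (\<lambda>t. p + axis 1 t) -` \<Omega>" for t
    using that by (intro zero) (auto simp: axis_def)
  then have "?\<phi> holomorphic_on (\<lambda>t. p + axis 1 t) -` \<Omega>"
    by (subst holomorphic_cong[OF refl, of _ _ "\<lambda>_. 0"]) auto
  then have "(deriv ^^ \<alpha> 1) ?\<phi> 0 = (deriv ^^ \<alpha> 1) (\<lambda>_. 0) 0"
    using z p by (intro higher_deriv_transform_within_open[OF _ _ op]) (auto simp: ax0)
  then show ?thesis unfolding multi_partial_2 funpow_partial_z[where j = "1::2"] by simp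
qed

text \<open>Wherever Fubini provides an integrable slice, the mean value property evaluates it at
  the centre of its disc; for b outside S the slice is empty.\<close>

lemma set_integral_slice_AE:
  fixes h :: "complex ^ 2 \<Rightarrow> complex"
  assumes \<Omega>: "open \<Omega>" and h: "mv_holomorphic_on h \<Omega>" and int: "set_integrable lborel \<Omega> h"
    and r: "\<And>b. b \<in> S \<Longrightarrow> 0 < r b"
    and slice: "\<And>a b. vector [a, b] \<in> \<Omega> \<longleftrightarrow> b \<in> S \<and> a \<in> ball (c b) (r b)"
  shows "AE b in lborel. (LINT a|lborel. indicator \<Omega> (vector [a, b]) *\<^sub>R h (vector [a, b]))
           = indicator S b *\<^sub>R (pi * (r b)\<^sup>2 * h (vector [c b, b]))"
proof -
  have "integrable lborel (\<lambda>w. indicator \<Omega> w *\<^sub>R h w)" using int by (simp add: set_integrable_def)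
  from Fubini_vector_2(1)[OF this] show ?thesis
  proof eventually_elim
    fix b assume ib: "integrable lborel (\<lambda>a. indicator \<Omega> (vector [a, b]) *\<^sub>R h (vector [a, b]))"
    show "(LINT a|lborel. indicator \<Omega> (vector [a, b]) *\<^sub>R h (vector [a, b]))
           = indicator S b *\<^sub>R (pi * (r b)\<^sup>2 * h (vector [c b, b]))"
    proof (cases "b \<in> S")
      case True
      then have ind: "indicator \<Omega> (vector [a, b]) = (indicator (ball (c b) (r b)) a :: real)" for a
        using slice by (simp add: indicator_def)
      have "(\<lambda>a. h (vector [0, b] + axis 1 a)) holomorphic_on ball (c b) (r b)"
        using True slice by (intro mv_holomorphic_on_slice[OF h]) (simp_all add: vector_2_eq_axis(1)[symmetric])
      then have "(\<lambda>a. h (vector [a, b])) holomorphic_on ball (c b) (r b)"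
        by (simp only: vector_2_eq_axis(1)[symmetric])
      from mean_value_ball[OF this r[OF True]] show ?thesis
        using ib True unfolding ind set_integrable_def set_lebesgue_integral_def by simp
    next
      case False
      then show ?thesis using slice by (simp add: indicator_def)
    qed
  qed
qed

section \<open>Test functions whose integral is a multiple of a point evaluation\<close>

locale test_function =
  fixes P :: "complex \<Rightarrow> complex" and x :: real
  assumes P: "P holomorphic_on UNIV" and x: "1 / 4 < x" "x < 1 / 2"
begin

definition denom :: "complex ^ 2 \<Rightarrow> complex" where
  "denom w = w $ 1 * (x + (1 - 3 * x) * (3 - w $ 2)) - (1 - 3 * x)"

definition test :: "complex ^ 2 \<Rightarrow> complex" where
  "test w = P (w $ 2) / (denom w)\<^sup>2"

text \<open>In terms of the preimage (z1, z2) the denominator is w1 * (x + (1 - 3 x) * z2), with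
  |w1| > 1/5 and |z2| < 1. The gap x - |1 - 3 x| is positive exactly for 1/4 < x < 1/2, which is the
  origin of this interval.\<close>

lemma norm_denom_ge:
  assumes w: "w \<in> coord_image"
  shows "(x - \<bar>1 - 3 * x\<bar>) / 5 \<le> norm (denom w)"
proof -
  let ?\<zeta> = "3 - w $ 2 - 1 / w $ 1"
  have nz: "w $ 1 \<noteq> 0" and z: "norm ?\<zeta> < 1" using w by (auto simp: coord_image_def)
  have eq: "denom w = w $ 1 * (x + (1 - 3 * x) * ?\<zeta>)"
    using nz by (simp add: denom_def field_simps)
  have r: "norm ((1 - 3 * x :: complex) * ?\<zeta>) = \<bar>1 - 3 * x\<bar> * norm ?\<zeta>"
    by (metis norm_mult norm_of_real of_real_1 of_real_diff of_real_mult of_real_numeral)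
  have "\<bar>1 - 3 * x\<bar> * norm ?\<zeta> \<le> \<bar>1 - 3 * x\<bar> * 1" using z by (intro mult_left_mono) auto
  moreover have "norm (of_real x :: complex) - norm ((1 - 3 * x :: complex) * ?\<zeta>) \<le> norm (x + (1 - 3 * x) * ?\<zeta>)"
    by (rule norm_diff_ineq)
  ultimately have "x - \<bar>1 - 3 * x\<bar> \<le> norm (x + (1 - 3 * x) * ?\<zeta>)"
    unfolding r using x by simp
  moreover have "0 \<le> x - \<bar>1 - 3 * x\<bar>" using x by linarith
  ultimately have "1 / 5 * (x - \<bar>1 - 3 * x\<bar>) \<le> norm (w $ 1) * norm (x + (1 - 3 * x) * ?\<zeta>)"
    using coord_image_bounds(2)[OF w] by (intro mult_mono) auto
  then show ?thesis unfolding eq norm_mult by simp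
qed

lemma gap_pos: "0 < x - \<bar>1 - 3 * x\<bar>" using x by linarith

lemma denom_nonzero: "w \<in> coord_image \<Longrightarrow> denom w \<noteq> 0"
  using norm_denom_ge[of w] gap_pos by auto

lemma mv_holomorphic_on_denom: "mv_holomorphic_on denom \<Omega>"
  unfolding denom_def[abs_def] by (intro mv_holomorphic_intros)

lemma test_holomorphic: "mv_holomorphic_on test coord_image"
  unfolding test_def[abs_def]
  by (intro mv_holomorphic_on_divide mv_holomorphic_on_power mv_holomorphic_on_denom
      mv_holomorphic_on_compose[OF mv_holomorphic_on_component P]) (auto simp: denom_nonzero)

lemma test_bounded: "\<exists>B. \<forall>w\<in>coord_image. norm (test w) \<le> B"
proof -
  have "compact (P ` cball 0 1)"
    using P by (intro compact_continuous_image holomorphic_on_imp_continuous_on holomorphic_on_subset[OF P]) auto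
  then obtain B where B: "\<And>b. norm b \<le> 1 \<Longrightarrow> norm (P b) \<le> B"
    by (metis bounded_iff compact_imp_bounded imageI mem_cball_0)
  let ?m = "(x - \<bar>1 - 3 * x\<bar>) / 5"
  have "norm (test w) \<le> B / ?m\<^sup>2" if w: "w \<in> coord_image" for w
    unfolding test_def norm_divide norm_power
  proof (rule frac_le)
    show "norm (P (w $ 2)) \<le> B" using coord_image_bounds(3)[OF w] by (intro B) simp
    then show "0 \<le> B" using norm_ge_zero order_trans by blast
    show "0 < ?m\<^sup>2" using gap_pos by simp
    show "?m\<^sup>2 \<le> (norm (denom w))\<^sup>2" using norm_denom_ge[OF w] gap_pos by (intro power_mono) auto
  qed
  then show ?thesis by blast
qed

lemma test_in_bergman_space: "test \<in> bergman_space coord_image"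
  and test_integrable: "set_integrable lborel coord_image test"
proof -
  obtain B where "\<And>w. w \<in> coord_image \<Longrightarrow> norm (test w) \<le> B" using test_bounded by blast
  from bounded_mv_holomorphic_in_bergman_space[OF test_holomorphic open_coord_image bounded_coord_image this]
  show "test \<in> bergman_space coord_image" "set_integrable lborel coord_image test" by auto
qed

text \<open>At the centre \<open>cnj A / d\<close> of the slice over \<open>b\<close>, the denominator is \<open>(1 - x * cnj b) / d\<close>,
  so the slice integrals produce the Bergman kernel of the disc at \<open>x\<close>.\<close>
lemma integral_test: "(LINT w:coord_image|lborel. test w) = pi\<^sup>2 * P x"
proof -
  define d where "d b = (norm (3 - b))\<^sup>2 - 1" for b :: complex
  define c where "c b = cnj (3 - b) / of_real (d b)" for b
  define F where "F w = indicator coord_image w *\<^sub>R test w" for w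
  define I where "I b = (LINT a|lborel. F (vector [a, b]))" for b
  define J where "J b = indicator (ball 0 1) b *\<^sub>R (pi * P b / (1 - x * cnj b)\<^sup>2)" for b
  have d: "0 < d b" if "b \<in> ball 0 1" for b
    using norm_three_minus(1)[of b 0] that by (simp add: d_def one_less_power)
  have slice: "vector [a, b] \<in> coord_image \<longleftrightarrow> b \<in> ball 0 1 \<and> a \<in> ball (c b) (1 / d b)" for a b
  proof (cases "norm b < 1")
    case True
    from coord_image_slice[OF this, of a] show ?thesis using True by (simp add: c_def d_def)
  qed (simp add: coord_image_def)
  \<comment> \<open>The squared radius 1 / d^2 from the area of the slice combines with the squared
    denominator at its centre, so that only d times this denominator enters.\<close>
  have val: "pi * (1 / d b)\<^sup>2 * test (vector [c b, b]) = pi * P b / (1 - x * cnj b)\<^sup>2" if b: "b \<in> ball 0 1" for b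
  proof -
    have AA: "cnj (3 - b) * (3 - b) = of_real (d b) + 1"
      using complex_norm_square[of "3 - b"] by (simp add: d_def mult.commute del: complex_cnj_diff)
    have "of_real (d b) * denom (vector [c b, b])
        = cnj (3 - b) * x + (1 - 3 * x) * (cnj (3 - b) * (3 - b)) - of_real (d b) * (1 - 3 * x)"
      using d[OF b] by (simp add: denom_def c_def field_simps)
    also have "\<dots> = 1 - x * cnj b" unfolding AA by (simp add: algebra_simps)
    finally have "of_real (d b) * denom (vector [c b, b]) = 1 - x * cnj b" .
    then have "(1 - x * cnj b)\<^sup>2 = (of_real (d b))\<^sup>2 * (denom (vector [c b, b]))\<^sup>2"
      by (metis power_mult_distrib)
    then show ?thesis by (simp add: test_def power_divide)
  qed
  have int: "integrable lborel F" using test_integrable by (simp add: F_def[abs_def] set_integrable_def)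
  have IJ: "AE b in lborel. I b = J b"
  proof -
    have "AE b in lborel. I b = indicator (ball 0 1) b *\<^sub>R (pi * (1 / d b)\<^sup>2 * test (vector [c b, b]))"
      unfolding I_def F_def
      using set_integral_slice_AE[OF open_coord_image test_holomorphic test_integrable, where S = "ball 0 1" and r = "\<lambda>b. 1 / d b", OF _ slice] d
      by simp
    then show ?thesis
    proof eventually_elim
      fix b
      assume "I b = indicator (ball 0 1) b *\<^sub>R (pi * (1 / d b)\<^sup>2 * test (vector [c b, b]))"
      then show "I b = J b" using val[of b] by (cases "b \<in> ball 0 1") (simp_all add: J_def)
    qed
  qed
  have nx: "norm (of_real x :: complex) < 1" using x by simp
  have Ph: "P holomorphic_on ball 0 1" using P by (rule holomorphic_on_subset) simp
  have "continuous_on (ball 0 1) (\<lambda>b. pi * P b / (1 - x * cnj b)\<^sup>2)"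
    using norm_one_minus_mult_cnj_pos(1)[OF nx]
    by (intro continuous_intros holomorphic_on_imp_continuous_on[OF Ph]) auto
  then have Jm: "J \<in> borel_measurable lborel"
    unfolding J_def using borel_measurable_continuous_on_indicator[of "ball 0 1"] by simp
  have iI: "integrable lborel I" unfolding I_def using Fubini_vector_2(2)[OF int] .
  then have iJ: "integrable lborel J"
    using IJ Jm by (subst integrable_cong_AE[where g = I]) (auto simp: borel_measurable_integrable)
  have "(LINT w:coord_image|lborel. test w) = (LINT w|lborel. F w)"
    by (simp add: F_def set_lebesgue_integral_def)
  also have "\<dots> = (LINT b|lborel. I b)" unfolding I_def by (rule Fubini_vector_2(3)[OF int, symmetric])
  also have "\<dots> = (LINT b|lborel. J b)"
    using iI Jm IJ by (intro integral_cong_AE) (auto simp: borel_measurable_integrable)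
  also have "\<dots> = (LINT b:ball 0 1|lborel. pi * P b / (1 - x * cnj b)\<^sup>2)"
    by (simp add: J_def set_lebesgue_integral_def)
  also have "\<dots> = pi * (pi * P x)"
    using iJ by (intro disc_kernel_reproducing nx holomorphic_intros Ph) (simp add: J_def[abs_def] set_integrable_def)
  finally show ?thesis by (simp add: power2_eq_square)
qed

end

section \<open>Refuting a putative quadrature formula\<close>

lemma not_quadrature_domain_coord_image: "\<not> quadrature_domain coord_image"
proof
  assume "quadrature_domain coord_image"
  then obtain S c where S: "finite S" "S \<subseteq> coord_image \<times> UNIV"
    and quad: "\<And>f. f \<in> bergman_space coord_image \<Longrightarrow>
       (LINT z:coord_image|lborel. f z) = (\<Sum>(z, \<alpha>)\<in>S. c z \<alpha> * multi_partial partial_z \<alpha> f z)"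
    unfolding quadrature_domain_def by blast
  \<comment> \<open>Avoiding the real parts of the second coordinates of the nodes is enough for the
    real number x to differ from all these coordinates.\<close>
  have "finite ((\<lambda>(p, \<alpha>). Re (p $ 2)) ` S)" using S by simp
  moreover have "infinite {1 / 4 <..< 1 / 2 :: real}" by simp
  ultimately obtain x where x_bounds: "1 / 4 < x" "x < 1 / 2" "x \<notin> (\<lambda>(p, \<alpha>). Re (p $ 2)) ` S"
    by (metis finite_subset greaterThanLessThan_iff subsetI)
  \<comment> \<open>The exponent exceeds by one the order of the derivative in the second variable.
    A node that occurs with several multi-indices receives one factor for each of them.\<close>
  define P where "P t = (\<Prod>(p, \<alpha>)\<in>S. (t - p $ 2) ^ Suc (\<alpha> 2))" for t
  have P: "P holomorphic_on UNIV"
    unfolding P_def by (intro holomorphic_intros) (auto intro!: holomorphic_intros simp: case_prod_unfold)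
  interpret test_function P x using P x_bounds by unfold_locales
  have "of_real x - p $ 2 \<noteq> 0" if "(p, \<alpha>) \<in> S" for p \<alpha>
  proof
    assume "of_real x - p $ 2 = 0"
    then have "x = Re (p $ 2)" by (metis Re_complex_of_real right_minus_eq)
    then show False using x_bounds(3) that by force
  qed
  then have "P x \<noteq> 0"
    using S(1) by (auto simp: P_def)
  moreover have "multi_partial partial_z \<alpha> test p = 0" if p: "(p, \<alpha>) \<in> S" for p \<alpha>
  proof (rule multi_partial_vanishes[OF open_coord_image])
    \<comment> \<open>Splitting off the factor of the current pair leaves a polynomial; divided by
      the squared denominator, it is the holomorphic cofactor that the vanishing criterion
      requires.\<close>
    let ?R = "\<lambda>t. \<Prod>(p, \<alpha>)\<in>S - {(p, \<alpha>)}. (t - p $ 2) ^ Suc (\<alpha> 2)"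
    show "p \<in> coord_image" using S p by auto
    have "?R holomorphic_on UNIV"
      by (intro holomorphic_intros) (auto intro!: holomorphic_intros simp: case_prod_unfold)
    then show "mv_holomorphic_on (\<lambda>w. ?R (w $ 2) / (denom w)\<^sup>2) coord_image"
      by (intro mv_holomorphic_on_divide mv_holomorphic_on_power mv_holomorphic_on_denom
          mv_holomorphic_on_compose[OF mv_holomorphic_on_component]) (auto simp: denom_nonzero)
    show "test w = (w $ 2 - p $ 2) ^ Suc (\<alpha> 2) * (?R (w $ 2) / (denom w)\<^sup>2)" for w
      using S(1) p by (simp add: test_def P_def prod.remove[of S "(p, \<alpha>)"])
  qed simp
  then have "(\<Sum>(z, \<alpha>)\<in>S. c z \<alpha> * multi_partial partial_z \<alpha> test z) = 0"
    by (intro sum.neutral) auto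
  ultimately show False
    using quad[OF test_in_bergman_space] integral_test by simp
qed

theorem proposition4p1:
  fixes f :: "complex ^ 2 \<Rightarrow> complex ^ 2"
  assumes "\<And>z. z \<in> unit_polydisc \<Longrightarrow> f z = vector [1 / (3 - z $ 1 - z $ 2), z $ 1]"
  shows "bergman_coordinate unit_polydisc f \<and>
         is_domain (f ` unit_polydisc) \<and> \<not> quadrature_domain (f ` unit_polydisc)"
proof -
  note f = assms
  have img: "f ` unit_polydisc = coord_image" by (rule coord_map_image[OF f])
  have nz: "3 - z $ 1 - z $ 2 \<noteq> 0" if "z \<in> unit_polydisc" for z :: "complex ^ 2"
    using norm_three_minus(1)[of "z $ 1" "z $ 2"] that by (auto simp: unit_polydisc_def)
  \<comment> \<open>The values of f are prescribed on the bidisc alone, so differentiability is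
    transferred from the explicit formula by openness.\<close>
  have hol1: "mv_holomorphic_on (\<lambda>z. f z $ 1) unit_polydisc"
    by (rule mv_holomorphic_on_transform[where f = "\<lambda>z. 1 / (3 - z $ 1 - z $ 2)", OF _ open_unit_polydisc])
       (use nz in \<open>auto intro!: mv_holomorphic_intros simp: f\<close>)
  have hol2: "mv_holomorphic_on (\<lambda>z. f z $ 2) unit_polydisc"
    by (rule mv_holomorphic_on_transform[where f = "\<lambda>z. z $ 1", OF _ open_unit_polydisc])
       (auto intro!: mv_holomorphic_intros simp: f)
  have hol: "mv_holomorphic_on (\<lambda>z. f z $ j) unit_polydisc" for j
    using exhaust_2[of j] hol1 hol2 by auto
  have inv1: "mv_holomorphic_on (\<lambda>w. the_inv_into unit_polydisc f w $ 1) coord_image"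
    by (rule mv_holomorphic_on_transform[where f = "\<lambda>w. w $ 2", OF _ open_coord_image])
       (auto intro!: mv_holomorphic_intros simp: coord_map_inverse[OF f])
  have inv2: "mv_holomorphic_on (\<lambda>w. the_inv_into unit_polydisc f w $ 2) coord_image"
    by (rule mv_holomorphic_on_transform[where f = "\<lambda>w. 3 - w $ 2 - 1 / w $ 1", OF _ open_coord_image])
       (auto intro!: mv_holomorphic_intros simp: coord_map_inverse[OF f], simp add: coord_image_def)
  have inv: "mv_holomorphic_on (\<lambda>w. the_inv_into unit_polydisc f w $ j) coord_image" for j
    using exhaust_2[of j] inv1 inv2 by auto
  have bihol: "biholomorphic_on f unit_polydisc"
    using hol inv by (simp add: biholomorphic_on_def holomorphic_map_on_def img open_coord_image coord_map_inj[OF f])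
  have "continuous_on unit_polydisc (\<lambda>z. \<chi> j. f z $ j)"
    by (intro continuous_intros mv_holomorphic_on_imp_continuous_on hol)
  then have "connected (f ` unit_polydisc)"
    by (intro connected_continuous_image convex_connected convex_unit_polydisc) simp
  then have dom: "is_domain coord_image"
    using img is_domain_unit_polydisc by (auto simp: is_domain_def open_coord_image)
  have one: "(\<lambda>z. 1) \<in> bergman_span unit_polydisc" and q: "(\<lambda>z. 3 - z $ 1 - z $ 2) \<in> bergman_span unit_polydisc"
    and p: "(\<lambda>z. z $ 1) \<in> bergman_span unit_polydisc"
    using affine_in_bergman_span_unit_polydisc[of 1 0 0] affine_in_bergman_span_unit_polydisc[of 3 "-1" "-1"]
      affine_in_bergman_span_unit_polydisc[of 0 1 0] by simp_all
  have z0: "0 \<in> unit_polydisc" by (simp add: unit_polydisc_def)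
  have "\<exists>p\<in>bergman_span unit_polydisc. \<exists>q\<in>bergman_span unit_polydisc.
        (\<exists>z\<in>unit_polydisc. q z \<noteq> 0) \<and> (\<forall>z\<in>unit_polydisc. q z \<noteq> 0 \<longrightarrow> f z $ j = p z / q z)" for j
  proof (cases "j = 1")
    case True
    show ?thesis
      by (rule bexI[OF _ one], rule bexI[OF _ q]) (use z0 True in \<open>auto simp: f intro!: bexI[of _ 0]\<close>)
  next
    case False
    then have "j = 2" using exhaust_2[of j] by auto
    then show ?thesis
      by (intro bexI[OF _ p] bexI[OF _ one]) (use z0 in \<open>auto simp: f\<close>)
  qed
  then show ?thesis
    using bihol dom is_domain_unit_polydisc not_quadrature_domain_coord_image
    by (simp add: bergman_coordinate_def img)
qed

end
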